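(* Let $\Gamma$ be a stationary Gibbs point process on $\mathbb{R}^d$ (with marks in $\mathbb{M}$) with Papangelou intensity $\lambda^*$. Assume that there are some $\alpha_1,\alpha_2>1$ with $\frac1{\alpha_1}+\frac1{\alpha_2}=1$ and $\delta\ge0$ such that (A1) $\displaystyle\int_{\mathbb{M}}\mathbb{E}\,|\lambda^*((0,m),\Gamma)|^{2\alpha_1}\,\lambda_{\mathbb{M}}(dm)<+\infty$; (A2) $\displaystyle\int_{\mathbb{R}^d\setminus B(0,\delta)}\left(\int_{\mathbb{M}^2}\mathbb{E}\left|1-\frac{\lambda^*((0,m_1),\Gamma\cup\{(y,m_2)\})}{\lambda^*((0,m_1),\Gamma)}\right|^{\alpha_2}\lambda_{\mathbb{M}}^2(d(m_1,m_2))\right)^{1/\alpha_2}dy<\infty$. Then there exists $\mathcal{C}_{nhyp}>0$ not depending on the bounded set $\Lambda\subset\mathbb{R}^d$ such that $$\frac{\mathrm{Var}(N_\Lambda(\Gamma))}{|\Lambda|}\ge\mathcal{C}_{nhyp}.$$ In particular, $\Gamma$ is not hyperuniform.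
   Context: $\mathbb{M}$ is a complete, separable mark space with its Borel $\sigma$-algebra and a finite measure $\lambda_{\mathbb{M}}$, and $\lambda_{\mathbb{M}}^2$ is the product measure $\lambda_{\mathbb{M}}\otimes\lambda_{\mathbb{M}}$ on $\mathbb{M}^2$; $E=\mathbb{R}^d\times\mathbb{M}$ carries the product $\sigma$-field and the reference measure $\nu=\lambda\otimes\lambda_{\mathbb{M}}$, where $\lambda$ is Lebesgue measure on $\mathbb{R}^d$; $|\Lambda|$ denotes the volume of $\Lambda$. $\mathbf{N}$ is the set of locally finite configurations, i.e. of all $\gamma\subset E$ such that $\gamma\cap(\Lambda\times\mathbb{M})$ is finite for every bounded $\Lambda\subset\mathbb{R}^d$, equipped with the smallest $\sigma$-field making all projections $\gamma\mapsto\gamma\cap A$ measurable for measurable $A\subset E$. A point process is a probability measure $\Gamma$ on $\mathbf{N}$; $\Gamma$ also denotes a random configuration with this law, and $\mathbb{E}$ and $\mathrm{Var}$ are taken with respect to it. For bounded $\Lambda\subset\mathbb{R}^d$, $N_\Lambda(\gamma)$ is the number of points of $\gamma$ in $\Lambda\times\mathbb{M}$. $B(x,r)$ is the Euclidean ball with centre $x$ and radius $r$. For $u\in\mathbb{R}^d$ let $\tau_u(x,m)=(x+u,m)$, applied pointwise to configurations; $\Gamma$ is stationary if $\tau_u\Gamma$ has the same distribution as $\Gamma$ for all $u\in\mathbb{R}^d$. Let $\lambda^*:E\times\mathbf{N}\to\mathbb{R}$ be a measurable function. $\Gamma$ is a Gibbs point process with Papangelou intensity $\lambda^*$ if for all positive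 measurable $f:E\times\mathbf{N}\to\mathbb{R}$, $$\int_{\mathbf{N}}\sum_{\mathbf{x}\in\gamma}f(\mathbf{x},\gamma\setminus\{\mathbf{x}\})\,\Gamma(d\gamma)=\int_{\mathbf{N}}\int_E f(\mathbf{x},\gamma)\lambda^*(\mathbf{x},\gamma)\,\nu(d\mathbf{x})\,\Gamma(d\gamma).$$ For stationary $\Gamma$, $\lambda^*$ is translation invariant: $\lambda^*(\mathbf{x},\gamma)=\lambda^*(\tau_u\mathbf{x},\tau_u\gamma)$ for all $u\in\mathbb{R}^d$. A stationary point process $\Gamma$ is hyperuniform if $\lim_{\Lambda\nearrow\mathbb{R}^d}\mathrm{Var}(N_\Lambda(\Gamma))/|\Lambda|=0$, where $\Lambda\nearrow\mathbb{R}^d$ means any sequence of increasing sets $\Lambda_1\subseteq\Lambda_2\subseteq\dots$ tending to the whole space $\mathbb{R}^d$.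
   Formalization: Γ is additionally assumed not to be almost surely the empty configuration (otherwise, e.g. for λ_M = 0, the variance is 0 and the claim fails); in (A2) the ratio is read with 0/0 = 1 and a/0 = ∞ for a ≠ 0. *)

theory Defs
  imports "HOL-Probability.Probability"
begin

type_synonym ('a, 'm) config = "('a \<times> 'm) set"

definition configs :: "('a::euclidean_space, 'm) config set" where
  "configs = {\<gamma>. \<forall>\<Lambda>. bounded \<Lambda> \<longrightarrow> finite (\<gamma> \<inter> (\<Lambda> \<times> UNIV))}"

text \<open>The \<open>\<sigma>\<close>-field on configurations is the one generated by the counting maps
  \<open>\<gamma> \<mapsto> N\<^sub>A(\<gamma>) \<in> {0, 1, \<dots>, \<infinity>}\<close> for measurable \<open>A\<close>. The explicit finiteness is needed because
  \<^const>\<open>card\<close> is \<open>0\<close> on infinite sets.\<close>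

definition conf_space :: "('a::euclidean_space, 'm::polish_space) config measure" where
  "conf_space = sigma configs
     {{\<gamma> \<in> configs. finite (\<gamma> \<inter> A) \<and> card (\<gamma> \<inter> A) = k} | A k.
        A \<in> sets (borel \<Otimes>\<^sub>M borel)}"

definition point_process :: "('a::euclidean_space, 'm::polish_space) config measure \<Rightarrow> bool" where
  "point_process \<Gamma> \<longleftrightarrow> prob_space \<Gamma> \<and> sets \<Gamma> = sets conf_space"

definition translate :: "'a::euclidean_space \<Rightarrow> 'a \<times> 'm \<Rightarrow> 'a \<times> 'm" where
  "translate u z = (fst z + u, snd z)"

definition stationary :: "('a::euclidean_space, 'm::polish_space) config measure \<Rightarrow> bool" where
  "stationary \<Gamma> \<longleftrightarrow> (\<forall>u. distr \<Gamma> conf_space (\<lambda>\<gamma>. translate u ` \<gamma>) = \<Gamma>)"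

definition ref_measure :: "'m::polish_space measure \<Rightarrow> ('a::euclidean_space \<times> 'm) measure" where
  "ref_measure \<mu> = lborel \<Otimes>\<^sub>M \<mu>"

text \<open>The intensity \<open>l\<close> is real valued. Testing the Georgii-Nguyen-Zessin identity below with
  the indicator of \<open>{l < 0}\<close> shows that it forces \<open>l \<ge> 0\<close> almost everywhere; this
  consequence has to be spelled out here, since \<^const>\<open>ennreal\<close> truncates negative values.
  The sum over the points of a configuration is the integral against counting measure.\<close>

definition gibbs_papangelou ::
  "'m::polish_space measure \<Rightarrow> ('a::euclidean_space, 'm) config measure
     \<Rightarrow> ('a \<times> 'm \<Rightarrow> ('a, 'm) config \<Rightarrow> real) \<Rightarrow> bool" where
  "gibbs_papangelou \<mu> \<Gamma> l \<longleftrightarrow>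
     point_process \<Gamma> \<and>
     (\<lambda>(x, \<gamma>). l x \<gamma>) \<in> borel_measurable (ref_measure \<mu> \<Otimes>\<^sub>M conf_space) \<and>
     (AE (x, \<gamma>) in ref_measure \<mu> \<Otimes>\<^sub>M \<Gamma>. 0 \<le> l x \<gamma>) \<and>
     (\<forall>f. (\<lambda>(x, \<gamma>). f x \<gamma>) \<in> borel_measurable (ref_measure \<mu> \<Otimes>\<^sub>M conf_space) \<longrightarrow>
          (\<forall>x \<gamma>. 0 \<le> f x \<gamma>) \<longrightarrow>
          (\<integral>\<^sup>+\<gamma>. (\<integral>\<^sup>+x. ennreal (f x (\<gamma> - {x})) \<partial>count_space \<gamma>) \<partial>\<Gamma>) =
          (\<integral>\<^sup>+\<gamma>. (\<integral>\<^sup>+x. ennreal (f x \<gamma> * l x \<gamma>) \<partial>ref_measure \<mu>) \<partial>\<Gamma>))"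

definition translation_invariant ::
  "('a::euclidean_space \<times> 'm \<Rightarrow> ('a, 'm) config \<Rightarrow> real) \<Rightarrow> bool" where
  "translation_invariant l \<longleftrightarrow>
     (\<forall>u x. \<forall>\<gamma>\<in>configs. l x \<gamma> = l (translate u x) (translate u ` \<gamma>))"

definition num_points :: "'a set \<Rightarrow> ('a, 'm) config \<Rightarrow> real" where
  "num_points \<Lambda> \<gamma> = real (card (\<gamma> \<inter> (\<Lambda> \<times> UNIV)))"

text \<open>The variance takes values in \<open>[0, \<infinity>]\<close>: the counts need not be square integrable, and
  \<open>prob_space.variance\<close> would return the junk value \<open>0\<close> in that case.\<close>

definition num_variance :: "('a::euclidean_space, 'm::polish_space) config measure \<Rightarrow> 'a set \<Rightarrow> ennreal" where
  "num_variance \<Gamma> \<Lambda> =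
     (\<integral>\<^sup>+\<gamma>. ennreal ((num_points \<Lambda> \<gamma> - (\<integral>\<gamma>'. num_points \<Lambda> \<gamma>' \<partial>\<Gamma>))\<^sup>2) \<partial>\<Gamma>)"

definition hyperuniform :: "('a::euclidean_space, 'm::polish_space) config measure \<Rightarrow> bool" where
  "hyperuniform \<Gamma> \<longleftrightarrow>
     (\<forall>\<Lambda> :: nat \<Rightarrow> 'a set.
        (\<forall>n. bounded (\<Lambda> n) \<and> \<Lambda> n \<in> sets borel) \<longrightarrow> incseq \<Lambda> \<longrightarrow> (\<Union>n. \<Lambda> n) = UNIV \<longrightarrow>
        (\<lambda>n. num_variance \<Gamma> (\<Lambda> n) / emeasure lborel (\<Lambda> n)) \<longlonglongrightarrow> 0)"

definition epowr :: "ennreal \<Rightarrow> real \<Rightarrow> ennreal" where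
  "epowr x p = (if x = \<infinity> then \<infinity> else ennreal (enn2real x powr p))"

text \<open>\<open>\<bar>1 - a / b\<bar>\<close> with the conventions \<open>0 / 0 = 1\<close> and \<open>\<bar>a / 0\<bar> = \<infinity>\<close> for \<open>a \<noteq> 0\<close>.
  The totalised real division, with \<open>0 / 0 = 0\<close>, would exclude hard-core interactions,
  for which the intensity vanishes with positive probability.\<close>

definition ratio_dev :: "real \<Rightarrow> real \<Rightarrow> ennreal" where
  "ratio_dev a b = (if b \<noteq> 0 then ennreal \<bar>1 - a / b\<bar> else if a = 0 then 0 else \<infinity>)"

end

theory Submission
  imports Defs
begin

text \<open>Write \<open>N\<close> for the number of points in the window \<open>\<Lambda>\<close> and \<open>L\<close> for its compensator, the integral of the
intensity \<open>\<lambda>*(x, \<gamma>)\<close> over \<open>\<Lambda>\<close> and the marks. The variance of \<open>N\<close> is bounded from below by the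
Cauchy-Schwarz inequality, tested against the innovation \<open>N - L\<close>:
\<open>Var N \<ge> Cov(N, N - L)\<^sup>2 / Var(N - L)\<close>.

The Georgii-Nguyen-Zessin identity computes all the moments involved. It gives
\<open>E N = E L = \<rho> |\<Lambda>|\<close> and \<open>E N\<^sup>2 = E (N L) + E L\<close> (\<open>gnz_count\<close>, \<open>gnz_count_squared\<close>), so that
\<open>Cov(N, N - L) = \<rho> |\<Lambda>|\<close>; here \<open>\<rho> > 0\<close> because the process is not almost surely empty. It also gives
\<open>E (N L)\<close> as the double integral of \<open>E (\<lambda>*(x, \<gamma>) \<lambda>*(y, \<gamma> \<union> {x}))\<close> (\<open>gnz_count_times\<close>), whence
\<open>Var(N - L) = E N\<^sup>2 - 2 E (N L) + E L\<^sup>2\<close> is \<open>\<rho> |\<Lambda>|\<close> plus the double integral over \<open>\<Lambda>\<close> of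
\<open>E (\<lambda>*(x, \<gamma>) (\<lambda>*(y, \<gamma>) - \<lambda>*(y, \<gamma> \<union> {x})))\<close>.

By stationarity the mean of the positive part of this integrand depends only on the difference of
the two positions, so the double integral is at most \<open>\<kappa> |\<Lambda>|\<close>, where \<open>\<kappa>\<close> is the integral over the
whole space of a function of one displacement (\<open>total_repulsion_le\<close>). That \<open>\<kappa>\<close> is finite is where the
two integrability conditions enter (\<open>repulsion_kernel_integrable\<close>): for displacements shorter than
\<open>\<delta>\<close> the integrand is dominated by \<open>\<lambda>*(x, \<gamma>) \<lambda>*(y, \<gamma>)\<close>, whose expectation is bounded by \<open>A1\<close>; for
longer ones it is \<open>\<lambda>*(x, \<gamma>) \<lambda>*(y, \<gamma>)\<close> times at most the relative deviation
\<open>|1 - \<lambda>*(y, \<gamma> \<union> {x}) / \<lambda>*(y, \<gamma>)|\<close>, and Hoelder's inequality with exponents \<open>\<alpha>1\<close> and \<open>\<alpha>2\<close> separates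
a moment controlled by \<open>A1\<close> from the integrand of \<open>A2\<close>.

Altogether \<open>Var N \<ge> \<rho>\<^sup>2 / (\<rho> + \<kappa>) |\<Lambda>|\<close>. Applied to growing balls this contradicts hyperuniformity.\<close>

section \<open>Measurability on the space of configurations\<close>

lemma space_conf_space [simp]: "space conf_space = configs"
  unfolding conf_space_def by (rule space_measure_of) auto

lemma space_borel_Times [simp]: "space (borel \<Otimes>\<^sub>M borel) = UNIV"
  by (simp add: space_pair_measure)

lemma pred_count [measurable]:
  assumes "A \<in> sets (borel \<Otimes>\<^sub>M borel)"
  shows "Measurable.pred conf_space (\<lambda>\<gamma>. finite (\<gamma> \<inter> A) \<and> card (\<gamma> \<inter> A) = k)"
proof -
  have "{\<gamma> \<in> configs. finite (\<gamma> \<inter> A) \<and> card (\<gamma> \<inter> A) = k} \<in> sets conf_space"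
    unfolding conf_space_def using assms by (subst sets_measure_of) auto
  then show ?thesis by (simp add: pred_def)
qed

text \<open>The generators of the \<sigma>-field make a configuration-valued map measurable as soon as all its
counts are.\<close>

lemma measurable_into_conf_space:
  fixes f :: "'b \<Rightarrow> ('a::euclidean_space, 'm::polish_space) config"
  assumes "\<And>x. x \<in> space M \<Longrightarrow> f x \<in> configs"
    and "\<And>A k. A \<in> sets (borel \<Otimes>\<^sub>M borel) \<Longrightarrow>
      Measurable.pred M (\<lambda>x. finite (f x \<inter> A) \<and> card (f x \<inter> A) = k)"
  shows "f \<in> measurable M conf_space"
  unfolding conf_space_def
proof (rule measurable_measure_of)
  fix y :: "('a, 'm) config set" assume "y \<in> {{\<gamma> \<in> configs. finite (\<gamma> \<inter> A) \<and> card (\<gamma> \<inter> A) = k} | A k.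
        A \<in> sets (borel \<Otimes>\<^sub>M borel)}"
  then obtain A k where A: "A \<in> sets (borel \<Otimes>\<^sub>M borel)"
    and y: "y = {\<gamma> \<in> configs. finite (\<gamma> \<inter> A) \<and> card (\<gamma> \<inter> A) = k}" by auto
  have "f -` y \<inter> space M = {x \<in> space M. finite (f x \<inter> A) \<and> card (f x \<inter> A) = k}"
    using assms(1) y by auto
  then show "f -` y \<inter> space M \<in> sets M"
    using assms(2)[OF A, of k] by (simp add: pred_def)
qed (use assms(1) in auto)

lemma finite_in_bounded_window:
  "\<gamma> \<in> configs \<Longrightarrow> bounded \<Lambda> \<Longrightarrow> finite (\<gamma> \<inter> (\<Lambda> \<times> UNIV))"
  by (simp add: configs_def)

text \<open>Local finiteness refers to the position only, so a neighbourhood of a point outside \<open>\<gamma>\<close> is cut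
down to \<open>B \<times> UNIV\<close> with \<open>B\<close> a ball of positions; finitely many points of \<open>\<gamma>\<close> remain to be
removed from it.\<close>

lemma closed_config:
  fixes \<gamma> :: "('a::euclidean_space, 'm::polish_space) config"
  assumes "\<gamma> \<in> configs"
  shows "closed \<gamma>"
  unfolding closed_def
proof (subst open_subopen, intro ballI)
  fix z :: "'a \<times> 'm" assume z: "z \<in> - \<gamma>"
  let ?W = "ball (fst z) 1 \<times> (UNIV :: 'm set)"
  have "open (?W - \<gamma> \<inter> ?W)"
    by (intro open_Diff open_Times finite_imp_closed finite_in_bounded_window[OF assms]) auto
  moreover have "z \<in> ?W - \<gamma> \<inter> ?W" using z by (cases z) auto
  ultimately show "\<exists>T. open T \<and> z \<in> T \<and> T \<subseteq> - \<gamma>" by blast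
qed

text \<open>Since \<open>\<gamma>\<close> is closed, \<open>z \<notin> \<gamma>\<close> holds exactly if some set \<open>U\<close> of a fixed countable basis contains \<open>z\<close>
and satisfies \<open>\<gamma> \<inter> U = {}\<close>. This writes the relation as a countable combination of measurable
rectangles, and it makes adding a random point to a random configuration a measurable
operation.\<close>

lemma pred_mem_config [measurable]:
  "Measurable.pred ((borel \<Otimes>\<^sub>M borel) \<Otimes>\<^sub>M conf_space)
     (\<lambda>(z :: 'a::euclidean_space \<times> 'm::polish_space, \<gamma>). z \<in> \<gamma>)"
proof -
  obtain B :: "('a \<times> 'm) set set" where B: "countable B" "topological_basis B"
    using ex_countable_basis by blast
  have meas: "U \<in> sets (borel \<Otimes>\<^sub>M borel)" if "U \<in> B" for U
    using borel_open[OF topological_basis_open[OF B(2) that]] by (simp add: borel_prod[symmetric])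
  have eq: "z \<in> \<gamma> \<longleftrightarrow> (\<forall>U\<in>B. z \<in> U \<longrightarrow> \<not> (finite (\<gamma> \<inter> U) \<and> card (\<gamma> \<inter> U) = 0))"
    if \<gamma>: "\<gamma> \<in> configs" for z \<gamma>
  proof
    assume R: "\<forall>U\<in>B. z \<in> U \<longrightarrow> \<not> (finite (\<gamma> \<inter> U) \<and> card (\<gamma> \<inter> U) = 0)"
    show "z \<in> \<gamma>"
    proof (rule ccontr)
      assume "z \<notin> \<gamma>"
      then obtain U where "U \<in> B" "z \<in> U" "U \<subseteq> - \<gamma>"
        using closed_config[OF \<gamma>] topological_basisE[OF B(2), of "- \<gamma>" z]
        by (metis ComplI closed_def)
      moreover from this have "\<gamma> \<inter> U = {}" by auto
      ultimately show False using R by (metis card.empty finite.emptyI)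
    qed
  qed (auto simp: card_gt_0_iff)
  have "Measurable.pred ((borel \<Otimes>\<^sub>M borel) \<Otimes>\<^sub>M conf_space)
     (\<lambda>p. \<forall>U\<in>B. fst p \<in> U \<longrightarrow> \<not> (finite (snd p \<inter> U) \<and> card (snd p \<inter> U) = 0))"
    unfolding pred_def
  proof (rule sets.sets_Collect_countable_All'[OF _ B(1)])
    fix U assume "U \<in> B"
    note [measurable] = meas[OF this]
    have "Measurable.pred ((borel \<Otimes>\<^sub>M borel) \<Otimes>\<^sub>M conf_space)
     (\<lambda>p. fst p \<in> U \<longrightarrow> \<not> (finite (snd p \<inter> U) \<and> card (snd p \<inter> U) = 0))"
      by measurable
    then show "{p \<in> space ((borel \<Otimes>\<^sub>M borel) \<Otimes>\<^sub>M conf_space).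
        fst p \<in> U \<longrightarrow> \<not> (finite (snd p \<inter> U) \<and> card (snd p \<inter> U) = 0)}
      \<in> sets ((borel \<Otimes>\<^sub>M borel) \<Otimes>\<^sub>M conf_space)"
      by (simp add: pred_def)
  qed
  then show ?thesis
    by (rule measurable_cong[THEN iffD2, rotated]) (auto simp: space_pair_measure eq)
qed

lemma insert_in_configs: "\<gamma> \<in> configs \<Longrightarrow> \<gamma> \<union> {z} \<in> configs"
  unfolding configs_def by (auto simp: Int_insert_left)

lemma measurable_add_point [measurable]:
  "(\<lambda>(z :: 'a::euclidean_space \<times> 'm::polish_space, \<gamma>). \<gamma> \<union> {z}) \<in>
     (borel \<Otimes>\<^sub>M borel) \<Otimes>\<^sub>M conf_space \<rightarrow>\<^sub>M conf_space"
proof (rule measurable_into_conf_space)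
  fix A :: "('a \<times> 'm) set" and k
  assume [measurable]: "A \<in> sets (borel \<Otimes>\<^sub>M borel)"
  have eq: "(finite ((case p of (z, \<gamma>) \<Rightarrow> \<gamma> \<union> {z}) \<inter> A) \<and> card ((case p of (z, \<gamma>) \<Rightarrow> \<gamma> \<union> {z}) \<inter> A) = k)
     \<longleftrightarrow> (if fst p \<in> A \<and> \<not> (case p of (z, \<gamma>) \<Rightarrow> z \<in> \<gamma>)
         then k > 0 \<and> finite (snd p \<inter> A) \<and> card (snd p \<inter> A) = k - 1
         else finite (snd p \<inter> A) \<and> card (snd p \<inter> A) = k)" for p :: "('a \<times> 'm) \<times> ('a, 'm) config"
  proof (cases p)
    case (Pair z \<gamma>)
    consider "z \<in> A \<and> z \<notin> \<gamma>" | "z \<notin> A" | "z \<in> A" "z \<in> \<gamma>" by blast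
    then show ?thesis
    proof cases
      case 1
      then have "(\<gamma> \<union> {z}) \<inter> A = insert z (\<gamma> \<inter> A)" by auto
      with 1 Pair show ?thesis by (auto simp: card_insert_if)
    next
      case 2
      then have "(\<gamma> \<union> {z}) \<inter> A = \<gamma> \<inter> A" by auto
      with 2 Pair show ?thesis by auto
    next
      case 3
      then have "(\<gamma> \<union> {z}) \<inter> A = \<gamma> \<inter> A" by auto
      with 3 Pair show ?thesis by auto
    qed
  qed
  show "Measurable.pred ((borel \<Otimes>\<^sub>M borel) \<Otimes>\<^sub>M conf_space)
    (\<lambda>p. finite ((case p of (z, \<gamma>) \<Rightarrow> \<gamma> \<union> {z}) \<inter> A) \<and> card ((case p of (z, \<gamma>) \<Rightarrow> \<gamma> \<union> {z}) \<inter> A) = k)"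
    unfolding eq by measurable
qed (auto simp: space_pair_measure insert_in_configs[simplified])

lemma measurable_num_points:
  assumes "bounded \<Lambda>" and [measurable]: "\<Lambda> \<in> sets borel"
  shows "num_points \<Lambda> \<in> borel_measurable (conf_space :: ('a::euclidean_space, 'm::polish_space) config measure)"
proof -
  have "(\<lambda>\<gamma>. card (\<gamma> \<inter> \<Lambda> \<times> UNIV)) \<in> (conf_space :: ('a, 'm) config measure) \<rightarrow>\<^sub>M count_space UNIV"
  proof (subst measurable_count_space_eq2_countable, safe)
    fix k :: nat
    have "Measurable.pred conf_space (\<lambda>\<gamma> :: ('a, 'm) config. finite (\<gamma> \<inter> \<Lambda> \<times> UNIV) \<and> card (\<gamma> \<inter> \<Lambda> \<times> UNIV) = k)"
      by measurable
    then have "{\<gamma> \<in> configs. finite (\<gamma> \<inter> \<Lambda> \<times> UNIV) \<and> card (\<gamma> \<inter> \<Lambda> \<times> UNIV) = k}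
        \<in> sets (conf_space :: ('a, 'm) config measure)"
      by (simp add: pred_def)
    also have "{\<gamma> \<in> configs. finite (\<gamma> \<inter> \<Lambda> \<times> UNIV) \<and> card (\<gamma> \<inter> \<Lambda> \<times> UNIV) = k}
        = (\<lambda>\<gamma>. card (\<gamma> \<inter> \<Lambda> \<times> UNIV)) -` {k} \<inter> space (conf_space :: ('a, 'm) config measure)"
      using finite_in_bounded_window[OF _ assms(1)] by auto
    finally show "(\<lambda>\<gamma>. card (\<gamma> \<inter> \<Lambda> \<times> UNIV)) -` {k} \<inter> space (conf_space :: ('a, 'm) config measure) \<in> sets conf_space" .
  qed auto
  then show ?thesis unfolding num_points_def by measurable
qed

lemma inj_translate: "inj (translate u)"
  by (auto simp: inj_on_def translate_def prod_eq_iff)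

lemma translate_in_configs:
  assumes "\<gamma> \<in> configs"
  shows "translate u ` \<gamma> \<in> configs"
  unfolding configs_def
proof (intro CollectI allI impI)
  fix \<Lambda> :: "'a set" assume "bounded \<Lambda>"
  then have "bounded ((\<lambda>x. x - u) ` \<Lambda>)" by (rule bounded_translation_minus)
  then have "finite (translate u ` (\<gamma> \<inter> (\<lambda>x. x - u) ` \<Lambda> \<times> UNIV))"
    using finite_in_bounded_window[OF assms] by blast
  moreover have "translate u ` \<gamma> \<inter> \<Lambda> \<times> UNIV \<subseteq> translate u ` (\<gamma> \<inter> (\<lambda>x. x - u) ` \<Lambda> \<times> UNIV)"
    by (force simp: translate_def)
  ultimately show "finite (translate u ` \<gamma> \<inter> \<Lambda> \<times> UNIV)" by (rule finite_subset[rotated])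
qed

lemma measurable_translate [measurable]:
  "(\<lambda>\<gamma>. translate u ` \<gamma>) \<in> (conf_space :: ('a::euclidean_space, 'm::polish_space) config measure) \<rightarrow>\<^sub>M conf_space"
proof (rule measurable_into_conf_space)
  fix A :: "('a \<times> 'm) set" and k
  assume A: "A \<in> sets (borel \<Otimes>\<^sub>M borel)"
  have "translate u \<in> (borel \<Otimes>\<^sub>M borel) \<rightarrow>\<^sub>M (borel \<Otimes>\<^sub>M (borel :: 'm measure))"
    unfolding translate_def by measurable
  from measurable_sets[OF this A] have [measurable]: "translate u -` A \<in> sets (borel \<Otimes>\<^sub>M borel)"
    by (simp add: space_pair_measure)
  have img: "translate u ` \<gamma> \<inter> A = translate u ` (\<gamma> \<inter> translate u -` A)" for \<gamma> by auto
  have fin: "finite (translate u ` S) \<longleftrightarrow> finite S" for S :: "('a \<times> 'm) set"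
    by (rule finite_image_iff) (rule inj_on_subset[OF inj_translate], simp)
  have crd: "card (translate u ` S) = card S" for S :: "('a \<times> 'm) set"
    by (rule card_image) (rule inj_on_subset[OF inj_translate], simp)
  show "Measurable.pred conf_space (\<lambda>\<gamma>. finite (translate u ` \<gamma> \<inter> A) \<and> card (translate u ` \<gamma> \<inter> A) = k)"
    unfolding img fin crd by measurable
qed (simp add: translate_in_configs)

lemma measurable_add_point' [measurable (raw)]:
  fixes f :: "'b \<Rightarrow> 'a::euclidean_space \<times> 'm::polish_space"
  assumes "f \<in> M \<rightarrow>\<^sub>M borel \<Otimes>\<^sub>M borel" "g \<in> M \<rightarrow>\<^sub>M conf_space"
  shows "(\<lambda>x. g x \<union> {f x}) \<in> M \<rightarrow>\<^sub>M conf_space"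
  using measurable_compose[OF measurable_Pair[OF assms] measurable_add_point] by simp

section \<open>The Georgii-Nguyen-Zessin identity for counts in a window\<close>

text \<open>Below, the intensity enters all moment computations as \<open>ennreal (l x \<gamma>)\<close>. This truncates negative
values of \<open>l\<close> exactly as the right-hand side of the Georgii-Nguyen-Zessin (GNZ) identity does, and it
allows sums and integrals to be exchanged freely.\<close>

locale stationary_gibbs =
  fixes \<mu> :: "'m::polish_space measure"
    and \<Gamma> :: "('a::euclidean_space, 'm) config measure"
    and l :: "'a \<times> 'm \<Rightarrow> ('a, 'm) config \<Rightarrow> real"
  assumes mark_sets: "sets \<mu> = sets borel"
    and mark_finite: "finite_measure \<mu>"
    and stat: "stationary \<Gamma>"
    and gibbs: "gibbs_papangelou \<mu> \<Gamma> l"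
    and inv: "translation_invariant l"
begin

lemma sets_\<Gamma>: "sets \<Gamma> = sets conf_space"
  using gibbs by (simp add: gibbs_papangelou_def point_process_def)

lemma space_\<Gamma> [simp]: "space \<Gamma> = configs"
  using sets_eq_imp_space_eq[OF sets_\<Gamma>] by simp

lemma sets_ref: "sets (ref_measure \<mu>) = sets (borel \<Otimes>\<^sub>M borel)"
  unfolding ref_measure_def by (intro sets_pair_measure_cong mark_sets sets_lborel)

lemma space_\<mu> [simp]: "space \<mu> = UNIV"
  using sets_eq_imp_space_eq[OF mark_sets] by simp

lemma space_ref [simp]: "space (ref_measure \<mu>) = UNIV"
  using sets_eq_imp_space_eq[OF sets_ref] by simp

lemmas sets_eqs [measurable_cong] = mark_sets sets_\<Gamma> sets_ref

sublocale \<Gamma>: prob_space \<Gamma>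
  using gibbs by (simp add: gibbs_papangelou_def point_process_def)

sublocale marks: finite_measure \<mu>
  by (rule mark_finite)

sublocale \<nu>: sigma_finite_measure "ref_measure \<mu>"
proof -
  interpret pair_sigma_finite lborel \<mu> by unfold_locales
  show "sigma_finite_measure (ref_measure \<mu>)"
    unfolding ref_measure_def by unfold_locales
qed

sublocale \<nu>\<Gamma>: pair_sigma_finite "ref_measure \<mu>" \<Gamma> by unfold_locales

lemma measurable_l [measurable (raw)]:
  assumes "f \<in> M \<rightarrow>\<^sub>M borel \<Otimes>\<^sub>M borel" "g \<in> M \<rightarrow>\<^sub>M conf_space"
  shows "(\<lambda>x. l (f x) (g x)) \<in> borel_measurable M"
proof -
  have "(\<lambda>(x, \<gamma>). l x \<gamma>) \<in> borel_measurable ((borel \<Otimes>\<^sub>M borel) \<Otimes>\<^sub>M conf_space)"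
    using gibbs unfolding gibbs_papangelou_def
    by (simp cong: measurable_cong_sets add: measurable_cong_sets[OF sets_pair_measure_cong[OF sets_ref refl] refl])
  from measurable_compose[OF measurable_Pair[OF assms] this] show ?thesis by simp
qed

abbreviation lam :: "'a \<times> 'm \<Rightarrow> ('a, 'm) config \<Rightarrow> ennreal"
  where "lam x \<gamma> \<equiv> ennreal (l x \<gamma>)"

text \<open>The GNZ identity makes this the compensator of the number of points in \<open>\<Lambda>\<close>: the difference of
the two, the innovation, has mean zero.\<close>

definition compensator :: "'a set \<Rightarrow> ('a, 'm) config \<Rightarrow> ennreal"
  where "compensator \<Lambda> \<gamma> = (\<integral>\<^sup>+x. indicator \<Lambda> (fst x) * lam x \<gamma> \<partial>ref_measure \<mu>)"

lemma measurable_compensator [measurable (raw)]: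
  assumes [measurable]: "g \<in> M \<rightarrow>\<^sub>M conf_space" and "\<Lambda> \<in> sets borel"
  shows "(\<lambda>x. compensator \<Lambda> (g x)) \<in> borel_measurable M"
proof -
  note [measurable] = assms(2)
  show ?thesis unfolding compensator_def by measurable
qed

text \<open>When \<open>f x (\<gamma> - {x})\<close> depends on \<open>x\<close> only through the indicator of the window, the sum over the points
of \<open>\<gamma>\<close> is a multiple of the number of points. The left-hand side of the GNZ identity is then
visibly a measurable function of \<open>\<gamma>\<close>.\<close>

lemma gnz_window:
  fixes f :: "'a \<times> 'm \<Rightarrow> ('a, 'm) config \<Rightarrow> real"
  assumes \<Lambda>: "bounded \<Lambda>" "\<Lambda> \<in> sets borel"
    and f: "(\<lambda>(x, \<gamma>). f x \<gamma>) \<in> borel_measurable ((borel \<Otimes>\<^sub>M borel) \<Otimes>\<^sub>M conf_space)"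
      "\<And>x \<gamma>. 0 \<le> f x \<gamma>"
    and fg: "\<And>x \<gamma>. \<gamma> \<in> configs \<Longrightarrow> x \<in> \<gamma> \<Longrightarrow> f x (\<gamma> - {x}) = indicator \<Lambda> (fst x) * g \<gamma>"
  shows "(\<integral>\<^sup>+\<gamma>. ennreal (num_points \<Lambda> \<gamma>) * ennreal (g \<gamma>) \<partial>\<Gamma>) =
    (\<integral>\<^sup>+\<gamma>. \<integral>\<^sup>+x. ennreal (f x \<gamma>) * lam x \<gamma> \<partial>ref_measure \<mu> \<partial>\<Gamma>)"
proof -
  have meas: "(\<lambda>(x, \<gamma>). f x \<gamma>) \<in> borel_measurable (ref_measure \<mu> \<Otimes>\<^sub>M conf_space)"
    using f(1) sets_pair_measure_cong[OF sets_ref refl] by (simp cong: measurable_cong_sets)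
  have sum: "(\<integral>\<^sup>+x. ennreal (f x (\<gamma> - {x})) \<partial>count_space \<gamma>)
      = ennreal (num_points \<Lambda> \<gamma>) * ennreal (g \<gamma>)" if \<gamma>: "\<gamma> \<in> configs" for \<gamma>
  proof -
    have "(\<integral>\<^sup>+x. ennreal (f x (\<gamma> - {x})) \<partial>count_space \<gamma>)
        = (\<integral>\<^sup>+x. ennreal (g \<gamma>) * indicator (\<gamma> \<inter> \<Lambda> \<times> UNIV) x \<partial>count_space \<gamma>)"
      using fg[OF \<gamma>] by (intro nn_integral_cong) (auto simp: indicator_def split: prod.splits)
    also have "\<dots> = ennreal (g \<gamma>) * emeasure (count_space \<gamma>) (\<gamma> \<inter> \<Lambda> \<times> UNIV)"
      by (rule nn_integral_cmult_indicator) auto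
    also have "emeasure (count_space \<gamma>) (\<gamma> \<inter> \<Lambda> \<times> UNIV) = ennreal (num_points \<Lambda> \<gamma>)"
      using finite_in_bounded_window[OF \<gamma> \<Lambda>(1)]
      by (simp add: emeasure_count_space_finite num_points_def ennreal_of_nat_eq_real_of_nat)
    finally show ?thesis by (simp add: mult.commute)
  qed
  have "(\<integral>\<^sup>+\<gamma>. ennreal (num_points \<Lambda> \<gamma>) * ennreal (g \<gamma>) \<partial>\<Gamma>)
      = (\<integral>\<^sup>+\<gamma>. (\<integral>\<^sup>+x. ennreal (f x (\<gamma> - {x})) \<partial>count_space \<gamma>) \<partial>\<Gamma>)"
    by (intro nn_integral_cong) (simp add: sum)
  also have "\<dots> = (\<integral>\<^sup>+\<gamma>. (\<integral>\<^sup>+x. ennreal (f x \<gamma> * l x \<gamma>) \<partial>ref_measure \<mu>) \<partial>\<Gamma>)"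
    using gibbs meas f(2) by (simp add: gibbs_papangelou_def)
  finally show ?thesis using f(2) by (simp add: ennreal_mult')
qed

lemma gnz_count:
  assumes "bounded \<Lambda>" and [measurable]: "\<Lambda> \<in> sets borel"
  shows "(\<integral>\<^sup>+\<gamma>. ennreal (num_points \<Lambda> \<gamma>) \<partial>\<Gamma>) = (\<integral>\<^sup>+\<gamma>. compensator \<Lambda> \<gamma> \<partial>\<Gamma>)"
  using gnz_window[OF assms, of "\<lambda>x _. indicator \<Lambda> (fst x)" "\<lambda>_. 1"]
  by (simp add: compensator_def ennreal_indicator)

text \<open>The test function is \<open>f x \<gamma> = 1 + N(\<gamma>)\<close> on the window, where \<open>N\<close> counts the points in \<open>\<Lambda>\<close>. Taking
\<open>1 + N(\<gamma>)\<close> rather than \<open>N(\<gamma> \<union> {x})\<close> gives the second moment exactly, without an argument that a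
typical position \<open>x\<close> carries no point of \<open>\<gamma>\<close>.\<close>

lemma gnz_count_squared:
  assumes "bounded \<Lambda>" and [measurable]: "\<Lambda> \<in> sets borel"
  shows "(\<integral>\<^sup>+\<gamma>. ennreal (num_points \<Lambda> \<gamma>) * ennreal (num_points \<Lambda> \<gamma>) \<partial>\<Gamma>) =
    (\<integral>\<^sup>+\<gamma>. ennreal (num_points \<Lambda> \<gamma>) * compensator \<Lambda> \<gamma> \<partial>\<Gamma>)
      + (\<integral>\<^sup>+\<gamma>. compensator \<Lambda> \<gamma> \<partial>\<Gamma>)"
proof -
  note [measurable] = measurable_num_points[OF assms, where 'm = 'm]
  have remove: "num_points \<Lambda> (\<gamma> - {x}) + 1 = num_points \<Lambda> \<gamma>"
    if "\<gamma> \<in> configs" "x \<in> \<gamma>" "fst x \<in> \<Lambda>" for x :: "'a \<times> 'm" and \<gamma>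
  proof -
    have "(\<gamma> - {x}) \<inter> \<Lambda> \<times> UNIV = (\<gamma> \<inter> \<Lambda> \<times> UNIV) - {x}" by auto
    moreover have "x \<in> \<gamma> \<inter> \<Lambda> \<times> UNIV" using that by (cases x) auto
    ultimately show ?thesis
      using card.remove[OF finite_in_bounded_window[OF that(1) assms(1)], of x]
      by (simp add: num_points_def)
  qed
  have "(\<integral>\<^sup>+\<gamma>. ennreal (num_points \<Lambda> \<gamma>) * ennreal (num_points \<Lambda> \<gamma>) \<partial>\<Gamma>)
    = (\<integral>\<^sup>+\<gamma>. \<integral>\<^sup>+x. ennreal (indicator \<Lambda> (fst x) * (num_points \<Lambda> \<gamma> + 1)) * lam x \<gamma> \<partial>ref_measure \<mu> \<partial>\<Gamma>)"
    by (rule gnz_window[OF assms, where f = "\<lambda>x \<gamma>. indicator \<Lambda> (fst x) * (num_points \<Lambda> \<gamma> + 1)"])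
       (measurable, auto simp: remove indicator_def, simp add: num_points_def)
  also have "\<dots> = (\<integral>\<^sup>+\<gamma>. \<integral>\<^sup>+x. (ennreal (num_points \<Lambda> \<gamma>) + 1) * (indicator \<Lambda> (fst x) * lam x \<gamma>) \<partial>ref_measure \<mu> \<partial>\<Gamma>)"
    by (intro nn_integral_cong) (auto simp: indicator_def num_points_def ennreal_plus)
  also have "\<dots> = (\<integral>\<^sup>+\<gamma>. (ennreal (num_points \<Lambda> \<gamma>) + 1) * compensator \<Lambda> \<gamma> \<partial>\<Gamma>)"
    unfolding compensator_def by (intro nn_integral_cong nn_integral_cmult) measurable
  also have "\<dots> = (\<integral>\<^sup>+\<gamma>. ennreal (num_points \<Lambda> \<gamma>) * compensator \<Lambda> \<gamma> + compensator \<Lambda> \<gamma> \<partial>\<Gamma>)"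
    by (simp add: distrib_right)
  also have "\<dots> = (\<integral>\<^sup>+\<gamma>. ennreal (num_points \<Lambda> \<gamma>) * compensator \<Lambda> \<gamma> \<partial>\<Gamma>)
      + (\<integral>\<^sup>+\<gamma>. compensator \<Lambda> \<gamma> \<partial>\<Gamma>)"
    by (intro nn_integral_add) measurable
  finally show ?thesis .
qed

text \<open>The defining identity quantifies over real test functions only. It is extended to the
\<open>[0, \<infinity>]\<close>-valued functions \<open>f x \<gamma> = g (\<gamma> \<union> {x})\<close> because \<open>g\<close> will be the compensator, which is finite
only almost surely. Both sides are linear and continuous along increasing sequences in \<open>g\<close>, which
reduces the claim to indicators.\<close>

lemma gnz_count_times:
  assumes "bounded \<Lambda>" and [measurable]: "\<Lambda> \<in> sets borel"
    and g: "g \<in> borel_measurable conf_space"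
  shows "(\<integral>\<^sup>+\<gamma>. ennreal (num_points \<Lambda> \<gamma>) * g \<gamma> \<partial>\<Gamma>) =
    (\<integral>\<^sup>+\<gamma>. \<integral>\<^sup>+x. (indicator \<Lambda> (fst x) * g (\<gamma> \<union> {x})) * lam x \<gamma> \<partial>ref_measure \<mu> \<partial>\<Gamma>)"
  using g
proof (induction rule: borel_measurable_induct)
  note [measurable] = measurable_num_points[OF assms(1,2), where 'm = 'm]
  {
    case (cong f g)
    have "(\<integral>\<^sup>+\<gamma>. ennreal (num_points \<Lambda> \<gamma>) * f \<gamma> \<partial>\<Gamma>) = (\<integral>\<^sup>+\<gamma>. ennreal (num_points \<Lambda> \<gamma>) * g \<gamma> \<partial>\<Gamma>)"
      using cong(3) by (intro nn_integral_cong) auto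
    moreover have "(\<integral>\<^sup>+\<gamma>. \<integral>\<^sup>+x. (indicator \<Lambda> (fst x) * f (\<gamma> \<union> {x})) * lam x \<gamma> \<partial>ref_measure \<mu> \<partial>\<Gamma>)
      = (\<integral>\<^sup>+\<gamma>. \<integral>\<^sup>+x. (indicator \<Lambda> (fst x) * g (\<gamma> \<union> {x})) * lam x \<gamma> \<partial>ref_measure \<mu> \<partial>\<Gamma>)"
      using cong(3) by (intro nn_integral_cong) (auto simp: insert_in_configs[simplified])
    ultimately show ?case using cong(4) by simp
  next
    case (set A)
    note [measurable] = set
    have "(\<lambda>(x, \<gamma>). indicat_real \<Lambda> (fst x) * indicat_real A (\<gamma> \<union> {x}))
        \<in> borel_measurable ((borel \<Otimes>\<^sub>M borel) \<Otimes>\<^sub>M conf_space)"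
      by measurable
    from gnz_window[OF assms(1,2) this, of "indicator A"] show ?case
      by (simp add: ennreal_indicator ennreal_mult' insert_absorb)
  next
    case (mult u c)
    note [measurable] = mult(2)
    have "(\<integral>\<^sup>+\<gamma>. ennreal (num_points \<Lambda> \<gamma>) * (c * u \<gamma>) \<partial>\<Gamma>)
        = (\<integral>\<^sup>+\<gamma>. c * (ennreal (num_points \<Lambda> \<gamma>) * u \<gamma>) \<partial>\<Gamma>)"
      by (simp add: ac_simps)
    also have "\<dots> = c * (\<integral>\<^sup>+\<gamma>. ennreal (num_points \<Lambda> \<gamma>) * u \<gamma> \<partial>\<Gamma>)"
      by (intro nn_integral_cmult) measurable
    also have "\<dots> = (\<integral>\<^sup>+\<gamma>. c * (\<integral>\<^sup>+x. (indicator \<Lambda> (fst x) * u (\<gamma> \<union> {x})) * lam x \<gamma> \<partial>ref_measure \<mu>) \<partial>\<Gamma>)"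
      unfolding mult by (intro nn_integral_cmult[symmetric]) measurable
    also have "\<dots> = (\<integral>\<^sup>+\<gamma>. (\<integral>\<^sup>+x. c * ((indicator \<Lambda> (fst x) * u (\<gamma> \<union> {x})) * lam x \<gamma>) \<partial>ref_measure \<mu>) \<partial>\<Gamma>)"
      by (intro nn_integral_cong nn_integral_cmult[symmetric]) measurable
    finally show ?case by (simp add: ac_simps)
  next
    case (add u v)
    note [measurable] = add(1,3)
    have "(\<integral>\<^sup>+\<gamma>. ennreal (num_points \<Lambda> \<gamma>) * (v \<gamma> + u \<gamma>) \<partial>\<Gamma>)
        = (\<integral>\<^sup>+\<gamma>. ennreal (num_points \<Lambda> \<gamma>) * v \<gamma> + ennreal (num_points \<Lambda> \<gamma>) * u \<gamma> \<partial>\<Gamma>)"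
      by (simp add: distrib_left)
    also have "\<dots> = (\<integral>\<^sup>+\<gamma>. ennreal (num_points \<Lambda> \<gamma>) * v \<gamma> \<partial>\<Gamma>) + (\<integral>\<^sup>+\<gamma>. ennreal (num_points \<Lambda> \<gamma>) * u \<gamma> \<partial>\<Gamma>)"
      by (intro nn_integral_add) measurable
    also have "\<dots> = (\<integral>\<^sup>+\<gamma>. (\<integral>\<^sup>+x. (indicator \<Lambda> (fst x) * v (\<gamma> \<union> {x})) * lam x \<gamma> \<partial>ref_measure \<mu>)
        + (\<integral>\<^sup>+x. (indicator \<Lambda> (fst x) * u (\<gamma> \<union> {x})) * lam x \<gamma> \<partial>ref_measure \<mu>) \<partial>\<Gamma>)"
      unfolding add by (intro nn_integral_add[symmetric]) measurable
    also have "\<dots> = (\<integral>\<^sup>+\<gamma>. (\<integral>\<^sup>+x. (indicator \<Lambda> (fst x) * v (\<gamma> \<union> {x})) * lam x \<gamma>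
        + (indicator \<Lambda> (fst x) * u (\<gamma> \<union> {x})) * lam x \<gamma> \<partial>ref_measure \<mu>) \<partial>\<Gamma>)"
      by (intro nn_integral_cong nn_integral_add[symmetric]) measurable
    finally show ?case by (simp add: distrib_left distrib_right)
  next
    case (seq U)
    note [measurable] = seq(1)
    have inc: "incseq (\<lambda>i. a * U i \<gamma> * b)" for a b \<gamma>
      using seq(3) by (auto simp: incseq_def le_fun_def intro!: mult_mono)
    have "(\<integral>\<^sup>+\<gamma>. ennreal (num_points \<Lambda> \<gamma>) * (SUP i. U i) \<gamma> \<partial>\<Gamma>)
        = (\<integral>\<^sup>+\<gamma>. (SUP i. ennreal (num_points \<Lambda> \<gamma>) * U i \<gamma>) \<partial>\<Gamma>)"
      by (simp add: SUP_mult_left_ennreal image_comp)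
    also have "\<dots> = (SUP i. \<integral>\<^sup>+\<gamma>. ennreal (num_points \<Lambda> \<gamma>) * U i \<gamma> \<partial>\<Gamma>)"
      using inc[of _ _ 1]
      by (intro nn_integral_monotone_convergence_SUP) (auto simp: incseq_def le_fun_def)
    also have "\<dots> = (SUP i. \<integral>\<^sup>+\<gamma>. \<integral>\<^sup>+x. (indicator \<Lambda> (fst x) * U i (\<gamma> \<union> {x})) * lam x \<gamma> \<partial>ref_measure \<mu> \<partial>\<Gamma>)"
      by (simp only: seq.IH)
    also have "\<dots> = (\<integral>\<^sup>+\<gamma>. (SUP i. \<integral>\<^sup>+x. (indicator \<Lambda> (fst x) * U i (\<gamma> \<union> {x})) * lam x \<gamma> \<partial>ref_measure \<mu>) \<partial>\<Gamma>)"
    proof (rule nn_integral_monotone_convergence_SUP[symmetric])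
      show "incseq (\<lambda>i \<gamma>. \<integral>\<^sup>+x. (indicator \<Lambda> (fst x) * U i (\<gamma> \<union> {x})) * lam x \<gamma> \<partial>ref_measure \<mu>)"
        by (intro incseq_SucI le_funI nn_integral_mono incseq_SucD[OF inc])
    qed measurable
    also have "\<dots> = (\<integral>\<^sup>+\<gamma>. (\<integral>\<^sup>+x. (SUP i. (indicator \<Lambda> (fst x) * U i (\<gamma> \<union> {x})) * lam x \<gamma>) \<partial>ref_measure \<mu>) \<partial>\<Gamma>)"
    proof (intro nn_integral_cong nn_integral_monotone_convergence_SUP[symmetric])
      fix \<gamma> show "incseq (\<lambda>i x. (indicator \<Lambda> (fst x) * U i (\<gamma> \<union> {x})) * lam x \<gamma>)"
        by (intro incseq_SucI le_funI incseq_SucD[OF inc])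
    qed measurable
    also have "\<dots> = (\<integral>\<^sup>+\<gamma>. (\<integral>\<^sup>+x. (indicator \<Lambda> (fst x) * (SUP i. U i) (\<gamma> \<union> {x})) * lam x \<gamma> \<partial>ref_measure \<mu>) \<partial>\<Gamma>)"
      by (simp only: SUP_mult_left_ennreal SUP_mult_right_ennreal SUP_apply)
    finally show ?case .
  }
qed

end

section \<open>Stationarity and the variance of the innovation\<close>

context stationary_gibbs
begin

lemma nn_integral_translate:
  assumes [measurable]: "F \<in> borel_measurable conf_space"
  shows "(\<integral>\<^sup>+\<gamma>. F (translate u ` \<gamma>) \<partial>\<Gamma>) = (\<integral>\<^sup>+\<gamma>. F \<gamma> \<partial>\<Gamma>)"
proof -
  have "(\<integral>\<^sup>+\<gamma>. F \<gamma> \<partial>\<Gamma>) = (\<integral>\<^sup>+\<gamma>. F \<gamma> \<partial>distr \<Gamma> conf_space (\<lambda>\<gamma>. translate u ` \<gamma>))"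
    using stat by (simp add: stationary_def)
  also have "\<dots> = (\<integral>\<^sup>+\<gamma>. F (translate u ` \<gamma>) \<partial>\<Gamma>)"
    by (rule nn_integral_distr) measurable
  finally show ?thesis by simp
qed

lemma l_translate:
  assumes "\<gamma> \<in> configs"
  shows "l (translate u x) (translate u ` \<gamma>) = l x \<gamma>"
  using inv assms unfolding translation_invariant_def by metis

lemma expectation_at_origin:
  assumes [measurable]: "\<phi> \<in> borel_measurable borel"
  shows "(\<integral>\<^sup>+\<gamma>. \<phi> (l (x, m) \<gamma>) \<partial>\<Gamma>) = (\<integral>\<^sup>+\<gamma>. \<phi> (l (0, m) \<gamma>) \<partial>\<Gamma>)"
proof -
  have "(\<integral>\<^sup>+\<gamma>. \<phi> (l (x, m) \<gamma>) \<partial>\<Gamma>) = (\<integral>\<^sup>+\<gamma>. \<phi> (l (translate x (0, m)) (translate x ` \<gamma>)) \<partial>\<Gamma>)"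
    by (subst nn_integral_translate[symmetric, of _ x]) (auto simp: translate_def)
  also have "\<dots> = (\<integral>\<^sup>+\<gamma>. \<phi> (l (0, m) \<gamma>) \<partial>\<Gamma>)"
    by (intro nn_integral_cong) (simp only: l_translate space_\<Gamma>)
  finally show ?thesis .
qed

definition intensity :: ennreal
  where "intensity = (\<integral>\<^sup>+m. \<integral>\<^sup>+\<gamma>. lam (0, m) \<gamma> \<partial>\<Gamma> \<partial>\<mu>)"

lemma nn_integral_compensator:
  assumes [measurable]: "\<Lambda> \<in> sets borel"
  shows "(\<integral>\<^sup>+\<gamma>. compensator \<Lambda> \<gamma> \<partial>\<Gamma>) = intensity * emeasure lborel \<Lambda>"
proof -
  have "(\<integral>\<^sup>+\<gamma>. compensator \<Lambda> \<gamma> \<partial>\<Gamma>)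
      = (\<integral>\<^sup>+x. \<integral>\<^sup>+\<gamma>. indicator \<Lambda> (fst x) * lam x \<gamma> \<partial>\<Gamma> \<partial>ref_measure \<mu>)"
    unfolding compensator_def by (rule \<nu>\<Gamma>.Fubini') measurable
  also have "\<dots> = (\<integral>\<^sup>+x. indicator \<Lambda> (fst x) * (\<integral>\<^sup>+\<gamma>. lam (0, snd x) \<gamma> \<partial>\<Gamma>) \<partial>ref_measure \<mu>)"
  proof (intro nn_integral_cong)
    fix x :: "'a \<times> 'm"
    have "(\<integral>\<^sup>+\<gamma>. indicator \<Lambda> (fst x) * lam x \<gamma> \<partial>\<Gamma>) = indicator \<Lambda> (fst x) * (\<integral>\<^sup>+\<gamma>. lam x \<gamma> \<partial>\<Gamma>)"
      by (rule nn_integral_cmult) measurable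
    also have "(\<integral>\<^sup>+\<gamma>. lam x \<gamma> \<partial>\<Gamma>) = (\<integral>\<^sup>+\<gamma>. lam (0, snd x) \<gamma> \<partial>\<Gamma>)"
      using expectation_at_origin[of ennreal "fst x" "snd x"] by simp
    finally show "(\<integral>\<^sup>+\<gamma>. indicator \<Lambda> (fst x) * lam x \<gamma> \<partial>\<Gamma>)
      = indicator \<Lambda> (fst x) * (\<integral>\<^sup>+\<gamma>. lam (0, snd x) \<gamma> \<partial>\<Gamma>)" .
  qed
  also have "\<dots> = (\<integral>\<^sup>+x. \<integral>\<^sup>+m. indicator \<Lambda> x * (\<integral>\<^sup>+\<gamma>. lam (0, m) \<gamma> \<partial>\<Gamma>) \<partial>\<mu> \<partial>lborel)"
    unfolding ref_measure_def by (subst marks.nn_integral_fst[symmetric]) auto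
  also have "\<dots> = (\<integral>\<^sup>+x. indicator \<Lambda> x * intensity \<partial>lborel)"
    unfolding intensity_def by (intro nn_integral_cong nn_integral_cmult) measurable
  also have "\<dots> = intensity * emeasure lborel \<Lambda>"
    by (simp add: nn_integral_multc mult.commute)
  finally show ?thesis .
qed

text \<open>The amount by which a point at \<open>x\<close> lowers the intensity at \<open>y\<close>, weighted by the intensity of having a
point at \<open>x\<close>. Subtraction on \<open>ennreal\<close> is truncated at \<open>0\<close>: an increase of the intensity is counted as
\<open>0\<close>, which is harmless since only an upper bound on the variance of the innovation is needed.\<close>

definition repulsion :: "'a \<times> 'm \<Rightarrow> 'a \<times> 'm \<Rightarrow> ('a, 'm) config \<Rightarrow> ennreal"
  where "repulsion x y \<gamma> = lam x \<gamma> * (lam y \<gamma> - lam y (\<gamma> \<union> {x}))"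

lemma measurable_repulsion [measurable (raw)]:
  assumes [measurable]: "f \<in> M \<rightarrow>\<^sub>M borel \<Otimes>\<^sub>M borel" "g \<in> M \<rightarrow>\<^sub>M borel \<Otimes>\<^sub>M borel" "h \<in> M \<rightarrow>\<^sub>M conf_space"
  shows "(\<lambda>x. repulsion (f x) (g x) (h x)) \<in> borel_measurable M"
  unfolding repulsion_def by measurable

lemma repulsion_translate:
  assumes "\<gamma> \<in> configs"
  shows "repulsion (translate u x) (translate u y) (translate u ` \<gamma>) = repulsion x y \<gamma>"
proof -
  have "translate u ` \<gamma> \<union> {translate u x} = translate u ` (\<gamma> \<union> {x})" by auto
  then show ?thesis
    unfolding repulsion_def by (simp only: l_translate assms insert_in_configs)
qed

lemma nn_integral_repulsion_translate:
  "(\<integral>\<^sup>+\<gamma>. repulsion (x, m2) (y, m1) \<gamma> \<partial>\<Gamma>) = (\<integral>\<^sup>+\<gamma>. repulsion (x - y, m2) (0, m1) \<gamma> \<partial>\<Gamma>)"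
proof -
  have "(\<integral>\<^sup>+\<gamma>. repulsion (x, m2) (y, m1) \<gamma> \<partial>\<Gamma>)
    = (\<integral>\<^sup>+\<gamma>. repulsion (translate y (x - y, m2)) (translate y (0, m1)) (translate y ` \<gamma>) \<partial>\<Gamma>)"
    by (subst nn_integral_translate[symmetric, of _ y]) (auto simp: translate_def)
  also have "\<dots> = (\<integral>\<^sup>+\<gamma>. repulsion (x - y, m2) (0, m1) \<gamma> \<partial>\<Gamma>)"
    by (intro nn_integral_cong) (simp only: repulsion_translate space_\<Gamma>)
  finally show ?thesis .
qed

text \<open>By stationarity the mean repulsion of two positions depends on their difference \<open>z\<close> alone. The
order \<open>(m1, m2)\<close> puts the mark of the point at the origin first.\<close>

definition repulsion_kernel :: "'a \<Rightarrow> ennreal"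
  where "repulsion_kernel z =
    (\<integral>\<^sup>+(m1, m2). (\<integral>\<^sup>+\<gamma>. repulsion (z, m2) (0, m1) \<gamma> \<partial>\<Gamma>) \<partial>(\<mu> \<Otimes>\<^sub>M \<mu>))"

sublocale marks2: sigma_finite_measure "\<mu> \<Otimes>\<^sub>M \<mu>"
proof -
  interpret pair_sigma_finite \<mu> \<mu> by unfold_locales
  show "sigma_finite_measure (\<mu> \<Otimes>\<^sub>M \<mu>)" by unfold_locales
qed

lemma nn_integral_shift_lborel:
  fixes f :: "'a \<Rightarrow> ennreal"
  assumes [measurable]: "f \<in> borel_measurable borel"
  shows "(\<integral>\<^sup>+x. f (x - y) \<partial>lborel) = (\<integral>\<^sup>+x. f x \<partial>lborel)"
proof -
  have "(\<integral>\<^sup>+x. f x \<partial>lborel) = (\<integral>\<^sup>+x. f x \<partial>distr lborel borel ((+) (- y)))"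
    by (simp add: lborel_distr_plus)
  also have "\<dots> = (\<integral>\<^sup>+x. f (x - y) \<partial>lborel)"
    by (subst nn_integral_distr) auto
  finally show ?thesis by simp
qed

text \<open>Keep only the constraint \<open>y \<in> \<Lambda>\<close> and let \<open>x\<close> range over the whole space: the integral over \<open>x\<close> is
then the same for every \<open>y\<close>, which makes the bound proportional to the volume of \<open>\<Lambda>\<close>.\<close>

lemma total_repulsion_le:
  assumes [measurable]: "\<Lambda> \<in> sets borel"
  shows "(\<integral>\<^sup>+\<gamma>. \<integral>\<^sup>+x. \<integral>\<^sup>+y. indicator \<Lambda> (fst x) * indicator \<Lambda> (fst y) * repulsion x y \<gamma>
      \<partial>ref_measure \<mu> \<partial>ref_measure \<mu> \<partial>\<Gamma>)
    \<le> (\<integral>\<^sup>+z. repulsion_kernel z \<partial>lborel) * emeasure lborel \<Lambda>"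
proof -
  define \<Phi> where "\<Phi> z m1 m2 = (\<integral>\<^sup>+\<gamma>. repulsion (z, m2) (0, m1) \<gamma> \<partial>\<Gamma>)" for z m1 m2
  have \<Phi>_meas [measurable (raw)]: "(\<lambda>x. \<Phi> (f x) (g x) (h x)) \<in> borel_measurable M"
    if [measurable]: "f \<in> M \<rightarrow>\<^sub>M borel" "g \<in> M \<rightarrow>\<^sub>M borel" "h \<in> M \<rightarrow>\<^sub>M borel"
    for f g h and M :: "'d measure"
    unfolding \<Phi>_def by measurable
  interpret mL: pair_sigma_finite \<mu> "lborel :: 'a measure" by unfold_locales
  interpret MM: pair_sigma_finite \<mu> \<mu> by unfold_locales
  have "(\<integral>\<^sup>+\<gamma>. \<integral>\<^sup>+x. \<integral>\<^sup>+y. indicator \<Lambda> (fst x) * indicator \<Lambda> (fst y) * repulsion x y \<gamma>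
      \<partial>ref_measure \<mu> \<partial>ref_measure \<mu> \<partial>\<Gamma>)
    \<le> (\<integral>\<^sup>+\<gamma>. \<integral>\<^sup>+x. \<integral>\<^sup>+y. indicator \<Lambda> (fst y) * repulsion x y \<gamma>
      \<partial>ref_measure \<mu> \<partial>ref_measure \<mu> \<partial>\<Gamma>)"
    by (intro nn_integral_mono) (auto simp: indicator_def)
  also have "\<dots> = (\<integral>\<^sup>+x. \<integral>\<^sup>+\<gamma>. \<integral>\<^sup>+y. indicator \<Lambda> (fst y) * repulsion x y \<gamma>
      \<partial>ref_measure \<mu> \<partial>\<Gamma> \<partial>ref_measure \<mu>)"
    by (rule \<nu>\<Gamma>.Fubini') measurable
  also have "\<dots> = (\<integral>\<^sup>+x. \<integral>\<^sup>+y. \<integral>\<^sup>+\<gamma>. indicator \<Lambda> (fst y) * repulsion x y \<gamma>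
      \<partial>\<Gamma> \<partial>ref_measure \<mu> \<partial>ref_measure \<mu>)"
    by (intro nn_integral_cong \<nu>\<Gamma>.Fubini') measurable
  also have "\<dots> = (\<integral>\<^sup>+x. \<integral>\<^sup>+y. indicator \<Lambda> (fst y) * \<Phi> (fst x - fst y) (snd y) (snd x)
      \<partial>ref_measure \<mu> \<partial>ref_measure \<mu>)"
  proof (intro nn_integral_cong)
    fix x y :: "'a \<times> 'm"
    have "(\<integral>\<^sup>+\<gamma>. indicator \<Lambda> (fst y) * repulsion x y \<gamma> \<partial>\<Gamma>) = indicator \<Lambda> (fst y) * (\<integral>\<^sup>+\<gamma>. repulsion x y \<gamma> \<partial>\<Gamma>)"
      by (rule nn_integral_cmult) measurable
    then show "(\<integral>\<^sup>+\<gamma>. indicator \<Lambda> (fst y) * repulsion x y \<gamma> \<partial>\<Gamma>)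
        = indicator \<Lambda> (fst y) * \<Phi> (fst x - fst y) (snd y) (snd x)"
      using nn_integral_repulsion_translate[of "fst x" "snd x" "fst y" "snd y"] by (simp add: \<Phi>_def)
  qed
  also have "\<dots> = (\<integral>\<^sup>+x. \<integral>\<^sup>+y. \<integral>\<^sup>+m1. indicator \<Lambda> y * \<Phi> (fst x - y) m1 (snd x)
      \<partial>\<mu> \<partial>lborel \<partial>ref_measure \<mu>)"
    unfolding ref_measure_def
    by (intro nn_integral_cong, subst marks.nn_integral_fst[symmetric]) auto
  also have "\<dots> = (\<integral>\<^sup>+x. \<integral>\<^sup>+m2. \<integral>\<^sup>+y. \<integral>\<^sup>+m1. indicator \<Lambda> y * \<Phi> (x - y) m1 m2
      \<partial>\<mu> \<partial>lborel \<partial>\<mu> \<partial>lborel)"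
    unfolding ref_measure_def
    by (subst marks.nn_integral_fst[symmetric]) auto
  also have "\<dots> = (\<integral>\<^sup>+x. \<integral>\<^sup>+y. \<integral>\<^sup>+m2. \<integral>\<^sup>+m1. indicator \<Lambda> y * \<Phi> (x - y) m1 m2
      \<partial>\<mu> \<partial>\<mu> \<partial>lborel \<partial>lborel)"
    by (intro nn_integral_cong mL.Fubini'[symmetric]) measurable
  also have "\<dots> = (\<integral>\<^sup>+x. \<integral>\<^sup>+y. indicator \<Lambda> y * repulsion_kernel (x - y) \<partial>lborel \<partial>lborel)"
  proof (intro nn_integral_cong)
    fix x y :: 'a
    have "(\<integral>\<^sup>+m2. \<integral>\<^sup>+m1. indicator \<Lambda> y * \<Phi> (x - y) m1 m2 \<partial>\<mu> \<partial>\<mu>)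
        = (\<integral>\<^sup>+p. (\<lambda>(m1, m2). indicator \<Lambda> y * \<Phi> (x - y) m1 m2) p \<partial>(\<mu> \<Otimes>\<^sub>M \<mu>))"
      by (subst MM.nn_integral_snd[symmetric]) auto
    also have "\<dots> = (\<integral>\<^sup>+p. indicator \<Lambda> y * (\<lambda>(m1, m2). \<Phi> (x - y) m1 m2) p \<partial>(\<mu> \<Otimes>\<^sub>M \<mu>))"
      by (intro nn_integral_cong) auto
    also have "\<dots> = indicator \<Lambda> y * repulsion_kernel (x - y)"
      unfolding repulsion_kernel_def \<Phi>_def[symmetric] by (rule nn_integral_cmult) measurable
    finally show "(\<integral>\<^sup>+m2. \<integral>\<^sup>+m1. indicator \<Lambda> y * \<Phi> (x - y) m1 m2 \<partial>\<mu> \<partial>\<mu>)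
      = indicator \<Lambda> y * repulsion_kernel (x - y)" .
  qed
  also have "\<dots> = (\<integral>\<^sup>+y. \<integral>\<^sup>+x. indicator \<Lambda> y * repulsion_kernel (x - y) \<partial>lborel \<partial>lborel)"
    unfolding repulsion_kernel_def by (rule lborel_pair.Fubini'[symmetric]) measurable
  also have "\<dots> = (\<integral>\<^sup>+y. indicator \<Lambda> y * (\<integral>\<^sup>+x. repulsion_kernel (x - y) \<partial>lborel) \<partial>lborel)"
    unfolding repulsion_kernel_def by (intro nn_integral_cong nn_integral_cmult) measurable
  also have "\<dots> = (\<integral>\<^sup>+y. indicator \<Lambda> y * (\<integral>\<^sup>+x. repulsion_kernel x \<partial>lborel) \<partial>lborel)"
    unfolding repulsion_kernel_def
    by (intro nn_integral_cong arg_cong2[where f = "(*)"] refl nn_integral_shift_lborel) measurable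
  also have "\<dots> = (\<integral>\<^sup>+z. repulsion_kernel z \<partial>lborel) * emeasure lborel \<Lambda>"
    by (simp add: nn_integral_multc mult.commute)
  finally show ?thesis .
qed

text \<open>By \<open>gnz_count_times\<close>, the mixed moment of count and compensator is the double integral of
\<open>lam x \<gamma> * lam y (\<gamma> \<union> {x})\<close>, while the second moment of the compensator is that of
\<open>lam x \<gamma> * lam y \<gamma>\<close>. Pointwise the second exceeds the first by at most the repulsion.\<close>

lemma compensator_squared_le:
  assumes "bounded \<Lambda>" and [measurable]: "\<Lambda> \<in> sets borel"
  shows "(\<integral>\<^sup>+\<gamma>. compensator \<Lambda> \<gamma> * compensator \<Lambda> \<gamma> \<partial>\<Gamma>)
    \<le> (\<integral>\<^sup>+\<gamma>. ennreal (num_points \<Lambda> \<gamma>) * compensator \<Lambda> \<gamma> \<partial>\<Gamma>)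
      + (\<integral>\<^sup>+z. repulsion_kernel z \<partial>lborel) * emeasure lborel \<Lambda>"
proof -
  let ?I = "\<lambda>x :: 'a \<times> 'm. indicator \<Lambda> (fst x) :: ennreal"
  have "(\<integral>\<^sup>+\<gamma>. compensator \<Lambda> \<gamma> * compensator \<Lambda> \<gamma> \<partial>\<Gamma>)
      = (\<integral>\<^sup>+\<gamma>. \<integral>\<^sup>+x. \<integral>\<^sup>+y. ?I x * lam x \<gamma> * (?I y * lam y \<gamma>) \<partial>ref_measure \<mu> \<partial>ref_measure \<mu> \<partial>\<Gamma>)"
  proof (intro nn_integral_cong)
    fix \<gamma> :: "('a, 'm) config" assume "\<gamma> \<in> space \<Gamma>"
    then have [simp]: "\<gamma> \<in> configs" by simp
    have "compensator \<Lambda> \<gamma> * compensator \<Lambda> \<gamma>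
      = (\<integral>\<^sup>+x. ?I x * lam x \<gamma> * compensator \<Lambda> \<gamma> \<partial>ref_measure \<mu>)"
      by (subst (1) compensator_def) (intro nn_integral_multc[symmetric], measurable)
    also have "\<dots> = (\<integral>\<^sup>+x. \<integral>\<^sup>+y. ?I x * lam x \<gamma> * (?I y * lam y \<gamma>) \<partial>ref_measure \<mu> \<partial>ref_measure \<mu>)"
      unfolding compensator_def by (intro nn_integral_cong nn_integral_cmult[symmetric]) measurable
    finally show "compensator \<Lambda> \<gamma> * compensator \<Lambda> \<gamma> = \<dots>" .
  qed
  also have "\<dots> \<le> (\<integral>\<^sup>+\<gamma>. \<integral>\<^sup>+x. \<integral>\<^sup>+y. ?I x * lam x \<gamma> * (?I y * lam y (\<gamma> \<union> {x})) + ?I x * ?I y * repulsion x y \<gamma>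
      \<partial>ref_measure \<mu> \<partial>ref_measure \<mu> \<partial>\<Gamma>)"
  proof (intro nn_integral_mono)
    fix x y and \<gamma> :: "('a, 'm) config"
    have "lam y \<gamma> \<le> lam y (\<gamma> \<union> {x}) + (lam y \<gamma> - lam y (\<gamma> \<union> {x}))"
      by (cases "lam y \<gamma> \<le> lam y (\<gamma> \<union> {x})") (auto simp: add_increasing2 add_diff_inverse_ennreal)
    then have "?I x * lam x \<gamma> * (?I y * lam y \<gamma>)
      \<le> ?I x * lam x \<gamma> * (?I y * (lam y (\<gamma> \<union> {x}) + (lam y \<gamma> - lam y (\<gamma> \<union> {x}))))"
      by (intro mult_mono) auto
    then show "?I x * lam x \<gamma> * (?I y * lam y \<gamma>)
      \<le> ?I x * lam x \<gamma> * (?I y * lam y (\<gamma> \<union> {x})) + ?I x * ?I y * repulsion x y \<gamma>"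
      by (simp add: repulsion_def distrib_left ac_simps)
  qed
  also have "\<dots> = (\<integral>\<^sup>+\<gamma>. \<integral>\<^sup>+x. \<integral>\<^sup>+y. ?I x * lam x \<gamma> * (?I y * lam y (\<gamma> \<union> {x})) \<partial>ref_measure \<mu> \<partial>ref_measure \<mu> \<partial>\<Gamma>)
     + (\<integral>\<^sup>+\<gamma>. \<integral>\<^sup>+x. \<integral>\<^sup>+y. ?I x * ?I y * repulsion x y \<gamma> \<partial>ref_measure \<mu> \<partial>ref_measure \<mu> \<partial>\<Gamma>)"
    by (subst nn_integral_add[symmetric], measurable, intro nn_integral_cong,
        subst nn_integral_add[symmetric], measurable, intro nn_integral_cong,
        rule nn_integral_add, measurable)
  also have "(\<integral>\<^sup>+\<gamma>. \<integral>\<^sup>+x. \<integral>\<^sup>+y. ?I x * lam x \<gamma> * (?I y * lam y (\<gamma> \<union> {x})) \<partial>ref_measure \<mu> \<partial>ref_measure \<mu> \<partial>\<Gamma>)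
    = (\<integral>\<^sup>+\<gamma>. \<integral>\<^sup>+x. (?I x * compensator \<Lambda> (\<gamma> \<union> {x})) * lam x \<gamma> \<partial>ref_measure \<mu> \<partial>\<Gamma>)"
  proof (intro nn_integral_cong)
    fix x and \<gamma> :: "('a, 'm) config" assume "\<gamma> \<in> space \<Gamma>"
    then have [simp]: "\<gamma> \<in> configs" by simp
    have "(\<integral>\<^sup>+y. ?I x * lam x \<gamma> * (?I y * lam y (\<gamma> \<union> {x})) \<partial>ref_measure \<mu>)
      = ?I x * lam x \<gamma> * compensator \<Lambda> (\<gamma> \<union> {x})"
      unfolding compensator_def by (intro nn_integral_cmult) measurable
    then show "(\<integral>\<^sup>+y. ?I x * lam x \<gamma> * (?I y * lam y (\<gamma> \<union> {x})) \<partial>ref_measure \<mu>)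
      = (?I x * compensator \<Lambda> (\<gamma> \<union> {x})) * lam x \<gamma>" by (simp add: ac_simps)
  qed
  also have "\<dots> = (\<integral>\<^sup>+\<gamma>. ennreal (num_points \<Lambda> \<gamma>) * compensator \<Lambda> \<gamma> \<partial>\<Gamma>)"
    by (rule gnz_count_times[symmetric, OF assms]) measurable
  finally show ?thesis
    using add_left_mono[OF total_repulsion_le[OF assms(2)]] order_trans by blast
qed

end

section \<open>Integrability of the repulsion kernel\<close>

lemma measurable_epowr [measurable (raw)]:
  assumes [measurable]: "f \<in> borel_measurable M"
  shows "(\<lambda>x. epowr (f x) p) \<in> borel_measurable M"
  unfolding epowr_def by measurable

lemma measurable_ratio_dev [measurable (raw)]:
  assumes [measurable]: "f \<in> borel_measurable M" "g \<in> borel_measurable M"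
  shows "(\<lambda>x. ratio_dev (f x) (g x)) \<in> borel_measurable M"
  unfolding ratio_dev_def by measurable

lemma mult_le_sum_powr_double:
  fixes a b p :: real
  assumes "a > 0" "b > 0" "p > 0"
  shows "(a * b) powr p \<le> a powr (2 * p) + b powr (2 * p)"
proof -
  have sq: "(max a b * max a b) powr p = max a b powr (2 * p)"
    using assms by (simp add: powr_mult powr_add[symmetric])
  have "(a * b) powr p \<le> (max a b * max a b) powr p"
    using assms by (intro powr_mono2 mult_mono) auto
  also have "\<dots> \<le> a powr (2 * p) + b powr (2 * p)"
    unfolding sq by (simp add: max_def)
  finally show ?thesis .
qed

context stationary_gibbs
begin

text \<open>Young's inequality for \<open>l x \<gamma> * l y \<gamma>\<close> and the relative deviation \<open>r\<close>, applied to \<open>(l x \<gamma> * l y \<gamma>) * (r / s)\<close>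
with a free scale \<open>s\<close>. Where \<open>l y \<gamma>\<close> vanishes there is no repulsion, which is why the value \<open>\<infinity>\<close> of
\<open>ratio_dev\<close> at \<open>a / 0\<close> causes no harm.\<close>

lemma repulsion_le_Young:
  assumes \<alpha>: "\<alpha>1 > 1" "\<alpha>2 > 1" "1 / \<alpha>1 + 1 / \<alpha>2 = 1" and s: "s > 0"
  shows "repulsion x y \<gamma> \<le> ennreal s * (ennreal (\<bar>l x \<gamma>\<bar> powr (2 * \<alpha>1)) + ennreal (\<bar>l y \<gamma>\<bar> powr (2 * \<alpha>1))
    + epowr (ratio_dev (l y (\<gamma> \<union> {x})) (l y \<gamma>)) \<alpha>2 / ennreal (s powr \<alpha>2))"
proof (cases "l x \<gamma> > 0 \<and> l y \<gamma> > 0")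
  case False
  then have "repulsion x y \<gamma> = 0" by (auto simp: repulsion_def ennreal_neg not_less)
  then show ?thesis by simp
next
  case True
  define a b b' where "a = l x \<gamma>" "b = l y \<gamma>" "b' = l y (\<gamma> \<union> {x})"
  have ab: "a > 0" "b > 0" using True by (auto simp: a_b_b'_def)
  define r where "r = \<bar>1 - b' / b\<bar>"
  have r: "r \<ge> 0" by (simp add: r_def)
  have "\<bar>b - b'\<bar> = b * r"
    using ab by (simp add: r_def abs_mult[symmetric, of b, simplified] abs_mult_pos' right_diff_distrib)
  then have br: "b - b' \<le> b * r" by linarith
  have "a * b * r = s * ((a * b) * (r / s))" using s by simp
  also have "(a * b) * (r / s) \<le> (a * b) powr \<alpha>1 / \<alpha>1 + (r / s) powr \<alpha>2 / \<alpha>2"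
    using ab r s by (intro Youngs_inequality \<alpha>) auto
  also have "\<dots> \<le> (a * b) powr \<alpha>1 / 1 + (r / s) powr \<alpha>2 / 1"
    using \<alpha> by (intro add_mono divide_left_mono) auto
  also have "(a * b) powr \<alpha>1 \<le> a powr (2 * \<alpha>1) + b powr (2 * \<alpha>1)"
    using ab \<alpha> by (intro mult_le_sum_powr_double) auto
  also have "(r / s) powr \<alpha>2 = r powr \<alpha>2 / s powr \<alpha>2"
    using r s by (simp add: powr_divide)
  finally have main: "a * b * r \<le> s * (a powr (2 * \<alpha>1) + b powr (2 * \<alpha>1) + r powr \<alpha>2 / s powr \<alpha>2)"
    using s by simp
  have "ennreal b - ennreal b' \<le> ennreal (b - b')"
    by (cases "b' \<ge> 0") (auto simp: ennreal_minus ennreal_neg intro!: ennreal_leI)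
  also have "\<dots> \<le> ennreal (b * r)" using br by (rule ennreal_leI)
  finally have "repulsion x y \<gamma> \<le> ennreal a * ennreal (b * r)"
    unfolding repulsion_def a_b_b'_def by (intro mult_left_mono) auto
  also have "\<dots> = ennreal (a * b * r)"
    using ab by (simp add: ennreal_mult' mult.assoc)
  also have "\<dots> \<le> ennreal (s * (a powr (2 * \<alpha>1) + b powr (2 * \<alpha>1) + r powr \<alpha>2 / s powr \<alpha>2))"
    by (rule ennreal_leI[OF main])
  also have "\<dots> = ennreal s * (ennreal (a powr (2 * \<alpha>1)) + ennreal (b powr (2 * \<alpha>1))
      + ennreal (r powr \<alpha>2) / ennreal (s powr \<alpha>2))"
    using s by (simp add: ennreal_mult' divide_ennreal ennreal_plus)
  also have "ennreal (r powr \<alpha>2) = epowr (ratio_dev b' b) \<alpha>2"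
    using ab r by (simp add: ratio_dev_def epowr_def r_def)
  finally show ?thesis using ab by (simp add: a_b_b'_def)
qed

lemma repulsion_le_moments:
  assumes \<alpha>: "\<alpha>1 > 1"
  shows "repulsion x y \<gamma> \<le> 2 + (ennreal (\<bar>l x \<gamma>\<bar> powr (2 * \<alpha>1)) + ennreal (\<bar>l y \<gamma>\<bar> powr (2 * \<alpha>1)))"
proof (cases "l x \<gamma> > 0 \<and> l y \<gamma> > 0")
  case False
  then have "repulsion x y \<gamma> = 0" by (auto simp: repulsion_def ennreal_neg not_less)
  then show ?thesis by simp
next
  case True
  have sq: "a powr 2 \<le> 1 + a powr (2 * \<alpha>1)" if "a > 0" for a :: real
  proof (cases "a \<le> 1")
    case True
    then have "a powr 2 \<le> 1" using that by (simp add: power_le_one)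
    then show ?thesis by (simp add: add_increasing2)
  next
    case False
    then have "a powr 2 \<le> a powr (2 * \<alpha>1)" using \<alpha> by (intro powr_mono) auto
    then show ?thesis by simp
  qed
  have "repulsion x y \<gamma> \<le> lam x \<gamma> * lam y \<gamma>"
    unfolding repulsion_def by (intro mult_left_mono) auto
  also have "\<dots> = ennreal ((l x \<gamma> * l y \<gamma>) powr 1)"
    using True by (simp add: ennreal_mult')
  also have "(l x \<gamma> * l y \<gamma>) powr 1 \<le> l x \<gamma> powr (2 * 1) + l y \<gamma> powr (2 * 1)"
    using True by (intro mult_le_sum_powr_double) auto
  also have "\<dots> \<le> 2 + (l x \<gamma> powr (2 * \<alpha>1) + l y \<gamma> powr (2 * \<alpha>1))"
    using sq[of "l x \<gamma>"] sq[of "l y \<gamma>"] True by simp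
  also have "ennreal \<dots> = 2 + (ennreal (\<bar>l x \<gamma>\<bar> powr (2 * \<alpha>1)) + ennreal (\<bar>l y \<gamma>\<bar> powr (2 * \<alpha>1)))"
    using True by (simp add: ennreal_plus)
  finally show ?thesis by (simp add: ennreal_leI)
qed

lemma finite_mark_mass: "emeasure \<mu> UNIV < \<infinity>"
  by (metis infinity_ennreal_def less_top marks.emeasure_finite)

definition moment :: "real \<Rightarrow> ennreal"
  where "moment p = (\<integral>\<^sup>+m. \<integral>\<^sup>+\<gamma>. ennreal (\<bar>l (0, m) \<gamma>\<bar> powr p) \<partial>\<Gamma> \<partial>\<mu>)"

lemma nn_integral_pair_moments:
  "(\<integral>\<^sup>+(m1, m2). (\<integral>\<^sup>+\<gamma>. ennreal (\<bar>l (z, m2) \<gamma>\<bar> powr p) + ennreal (\<bar>l (0, m1) \<gamma>\<bar> powr p) \<partial>\<Gamma>) \<partial>(\<mu> \<Otimes>\<^sub>M \<mu>))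
    = 2 * (emeasure \<mu> UNIV * moment p)"
proof -
  let ?q = "\<lambda>m. \<integral>\<^sup>+\<gamma>. ennreal (\<bar>l (0, m) \<gamma>\<bar> powr p) \<partial>\<Gamma>"
  have "(\<integral>\<^sup>+\<gamma>. ennreal (\<bar>l (z, m2) \<gamma>\<bar> powr p) + ennreal (\<bar>l (0, m1) \<gamma>\<bar> powr p) \<partial>\<Gamma>) = ?q m2 + ?q m1"
    for m1 m2
    using expectation_at_origin[of "\<lambda>t. ennreal (\<bar>t\<bar> powr p)" z m2]
    by (subst nn_integral_add) auto
  then have "(\<integral>\<^sup>+(m1, m2). (\<integral>\<^sup>+\<gamma>. ennreal (\<bar>l (z, m2) \<gamma>\<bar> powr p) + ennreal (\<bar>l (0, m1) \<gamma>\<bar> powr p) \<partial>\<Gamma>) \<partial>(\<mu> \<Otimes>\<^sub>M \<mu>))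
    = (\<integral>\<^sup>+(m1, m2). ?q m2 + ?q m1 \<partial>(\<mu> \<Otimes>\<^sub>M \<mu>))" by simp
  also have "\<dots> = (\<integral>\<^sup>+m1. \<integral>\<^sup>+m2. ?q m2 + ?q m1 \<partial>\<mu> \<partial>\<mu>)"
    by (subst marks.nn_integral_fst[symmetric]) auto
  also have "\<dots> = (\<integral>\<^sup>+m1. moment p + ?q m1 * emeasure \<mu> UNIV \<partial>\<mu>)"
    unfolding moment_def by (intro nn_integral_cong) (subst nn_integral_add, auto)
  also have "\<dots> = moment p * emeasure \<mu> UNIV + moment p * emeasure \<mu> UNIV"
    by (subst nn_integral_add) (auto simp: nn_integral_multc moment_def)
  finally show ?thesis by (simp add: mult_2 mult.commute)
qed

text \<open>The bound used for nearby points, where the deviation of the intensity is not controlled and only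
the moments of the intensity are available. It is uniform in \<open>z\<close>, hence integrable over any ball.\<close>

lemma repulsion_kernel_near:
  assumes "\<alpha>1 > 1"
  shows "repulsion_kernel z
    \<le> 2 * (emeasure \<mu> UNIV * emeasure \<mu> UNIV) + 2 * (emeasure \<mu> UNIV * moment (2 * \<alpha>1))"
proof -
  have "repulsion_kernel z \<le> (\<integral>\<^sup>+(m1, m2). 2 + (\<integral>\<^sup>+\<gamma>. ennreal (\<bar>l (z, m2) \<gamma>\<bar> powr (2 * \<alpha>1))
      + ennreal (\<bar>l (0, m1) \<gamma>\<bar> powr (2 * \<alpha>1)) \<partial>\<Gamma>) \<partial>(\<mu> \<Otimes>\<^sub>M \<mu>))"
    unfolding repulsion_kernel_def
  proof (intro nn_integral_mono, clarify)
    fix m1 m2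
    have "(\<integral>\<^sup>+\<gamma>. repulsion (z, m2) (0, m1) \<gamma> \<partial>\<Gamma>) \<le> (\<integral>\<^sup>+\<gamma>. 2 + (ennreal (\<bar>l (z, m2) \<gamma>\<bar> powr (2 * \<alpha>1))
      + ennreal (\<bar>l (0, m1) \<gamma>\<bar> powr (2 * \<alpha>1))) \<partial>\<Gamma>)"
      by (intro nn_integral_mono repulsion_le_moments assms)
    also have "\<dots> = 2 + (\<integral>\<^sup>+\<gamma>. ennreal (\<bar>l (z, m2) \<gamma>\<bar> powr (2 * \<alpha>1))
      + ennreal (\<bar>l (0, m1) \<gamma>\<bar> powr (2 * \<alpha>1)) \<partial>\<Gamma>)"
      using \<Gamma>.emeasure_space_1 by (subst nn_integral_add) auto
    finally show "(\<integral>\<^sup>+\<gamma>. repulsion (z, m2) (0, m1) \<gamma> \<partial>\<Gamma>) \<le> \<dots>" .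
  qed
  also have "\<dots> = (\<integral>\<^sup>+p. 2 \<partial>(\<mu> \<Otimes>\<^sub>M \<mu>)) + (\<integral>\<^sup>+(m1, m2). (\<integral>\<^sup>+\<gamma>. ennreal (\<bar>l (z, m2) \<gamma>\<bar> powr (2 * \<alpha>1))
      + ennreal (\<bar>l (0, m1) \<gamma>\<bar> powr (2 * \<alpha>1)) \<partial>\<Gamma>) \<partial>(\<mu> \<Otimes>\<^sub>M \<mu>))"
    by (subst nn_integral_add[symmetric]) (auto simp: case_prod_unfold)
  also have "(\<integral>\<^sup>+p. 2 \<partial>(\<mu> \<Otimes>\<^sub>M \<mu>)) = 2 * (emeasure \<mu> UNIV * emeasure \<mu> UNIV)"
    using marks.emeasure_pair_measure_Times[of "UNIV" \<mu> UNIV] sets.top[of \<mu>]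
    by (simp add: space_pair_measure)
  finally show ?thesis by (simp add: nn_integral_pair_moments)
qed

definition deviation_moment :: "real \<Rightarrow> 'a \<Rightarrow> ennreal"
  where "deviation_moment p z = (\<integral>\<^sup>+(m1, m2).
    (\<integral>\<^sup>+\<gamma>. epowr (ratio_dev (l (0, m1) (\<gamma> \<union> {(z, m2)})) (l (0, m1) \<gamma>)) p \<partial>\<Gamma>) \<partial>(\<mu> \<Otimes>\<^sub>M \<mu>))"

lemma repulsion_kernel_scaled_Young:
  assumes \<alpha>: "\<alpha>1 > 1" "\<alpha>2 > 1" "1 / \<alpha>1 + 1 / \<alpha>2 = 1" and s: "s > 0"
  shows "repulsion_kernel z \<le> ennreal s *
    (2 * (emeasure \<mu> UNIV * moment (2 * \<alpha>1)) + deviation_moment \<alpha>2 z / ennreal (s powr \<alpha>2))"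
proof -
  let ?q = "\<lambda>x \<gamma>. ennreal (\<bar>l x \<gamma>\<bar> powr (2 * \<alpha>1))"
  let ?b = "\<lambda>m1 m2 \<gamma>. epowr (ratio_dev (l (0, m1) (\<gamma> \<union> {(z, m2)})) (l (0, m1) \<gamma>)) \<alpha>2"
  have "repulsion_kernel z \<le> (\<integral>\<^sup>+(m1, m2). ennreal s * ((\<integral>\<^sup>+\<gamma>. ?q (z, m2) \<gamma> + ?q (0, m1) \<gamma> \<partial>\<Gamma>)
      + (\<integral>\<^sup>+\<gamma>. ?b m1 m2 \<gamma> \<partial>\<Gamma>) / ennreal (s powr \<alpha>2)) \<partial>(\<mu> \<Otimes>\<^sub>M \<mu>))"
    unfolding repulsion_kernel_def
  proof (intro nn_integral_mono, clarify)
    fix m1 m2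
    have "(\<integral>\<^sup>+\<gamma>. repulsion (z, m2) (0, m1) \<gamma> \<partial>\<Gamma>)
      \<le> (\<integral>\<^sup>+\<gamma>. ennreal s * (?q (z, m2) \<gamma> + ?q (0, m1) \<gamma> + ?b m1 m2 \<gamma> / ennreal (s powr \<alpha>2)) \<partial>\<Gamma>)"
      by (intro nn_integral_mono repulsion_le_Young assms)
    also have "\<dots> = ennreal s * (\<integral>\<^sup>+\<gamma>. ?q (z, m2) \<gamma> + ?q (0, m1) \<gamma> + ?b m1 m2 \<gamma> / ennreal (s powr \<alpha>2) \<partial>\<Gamma>)"
      by (rule nn_integral_cmult) measurable
    also have "(\<integral>\<^sup>+\<gamma>. ?q (z, m2) \<gamma> + ?q (0, m1) \<gamma> + ?b m1 m2 \<gamma> / ennreal (s powr \<alpha>2) \<partial>\<Gamma>)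
      = (\<integral>\<^sup>+\<gamma>. ?q (z, m2) \<gamma> + ?q (0, m1) \<gamma> \<partial>\<Gamma>) + (\<integral>\<^sup>+\<gamma>. ?b m1 m2 \<gamma> / ennreal (s powr \<alpha>2) \<partial>\<Gamma>)"
      by (rule nn_integral_add) measurable
    also have "(\<integral>\<^sup>+\<gamma>. ?b m1 m2 \<gamma> / ennreal (s powr \<alpha>2) \<partial>\<Gamma>) = (\<integral>\<^sup>+\<gamma>. ?b m1 m2 \<gamma> \<partial>\<Gamma>) / ennreal (s powr \<alpha>2)"
      by (rule nn_integral_divide) measurable
    finally show "(\<integral>\<^sup>+\<gamma>. repulsion (z, m2) (0, m1) \<gamma> \<partial>\<Gamma>)
      \<le> ennreal s * ((\<integral>\<^sup>+\<gamma>. ?q (z, m2) \<gamma> + ?q (0, m1) \<gamma> \<partial>\<Gamma>)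
        + (\<integral>\<^sup>+\<gamma>. ?b m1 m2 \<gamma> \<partial>\<Gamma>) / ennreal (s powr \<alpha>2))" .
  qed
  also have "\<dots> = ennreal s * ((\<integral>\<^sup>+(m1, m2). (\<integral>\<^sup>+\<gamma>. ?q (z, m2) \<gamma> + ?q (0, m1) \<gamma> \<partial>\<Gamma>) \<partial>(\<mu> \<Otimes>\<^sub>M \<mu>))
      + deviation_moment \<alpha>2 z / ennreal (s powr \<alpha>2))"
    unfolding deviation_moment_def case_prod_unfold
    by (subst nn_integral_cmult, measurable, subst nn_integral_add, measurable, subst nn_integral_divide, measurable)
  finally show ?thesis by (simp only: nn_integral_pair_moments)
qed

text \<open>Hoelder's inequality, obtained from the previous bound by optimising the scale: with
\<open>D = deviation_moment \<alpha>2 z\<close>, the choice \<open>s = D powr (1 / \<alpha>2)\<close> turns the last summand into \<open>1\<close>. If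
\<open>D = 0\<close>, let \<open>s\<close> tend to \<open>0\<close>.\<close>

lemma repulsion_kernel_Hoelder:
  assumes \<alpha>: "\<alpha>1 > 1" "\<alpha>2 > 1" "1 / \<alpha>1 + 1 / \<alpha>2 = 1"
    and fin: "moment (2 * \<alpha>1) < \<infinity>"
  shows "repulsion_kernel z \<le> (2 * (emeasure \<mu> UNIV * moment (2 * \<alpha>1)) + 1)
    * epowr (deviation_moment \<alpha>2 z) (1 / \<alpha>2)"
proof -
  define V where "V = 2 * (emeasure \<mu> UNIV * moment (2 * \<alpha>1))"
  have V: "V < \<infinity>"
    using fin finite_mark_mass unfolding V_def
    by (auto simp: ennreal_mult_less_top)
  note young = repulsion_kernel_scaled_Young[OF \<alpha>, where z = z, folded V_def]
  show ?thesis
    unfolding V_def[symmetric]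
  proof (cases "deviation_moment \<alpha>2 z")
    case top
    then show "repulsion_kernel z \<le> (V + 1) * epowr (deviation_moment \<alpha>2 z) (1 / \<alpha>2)"
      by (simp add: epowr_def ennreal_mult_top)
  next
    case (real b)
    show "repulsion_kernel z \<le> (V + 1) * epowr (deviation_moment \<alpha>2 z) (1 / \<alpha>2)"
    proof (cases "b = 0")
      case True
      have "repulsion_kernel z \<le> 0"
      proof (rule ennreal_le_epsilon)
        fix e :: real assume e: "e > 0"
        obtain v where v: "V = ennreal v" "v \<ge> 0" using V by (cases V) auto
        have "repulsion_kernel z \<le> ennreal (e / (v + 1)) * V"
          using young[of "e / (v + 1)"] e v real True by simp
        also have "\<dots> = ennreal (e / (v + 1) * v)"
          unfolding v(1) by (rule ennreal_mult'[symmetric]) (use v e in simp)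
        also have "e / (v + 1) * v \<le> e" using v e by (simp add: field_simps)
        finally show "repulsion_kernel z \<le> 0 + ennreal e" by (simp add: ennreal_leI)
      qed
      then show ?thesis by simp
    next
      case False
      with real have b: "b > 0" by simp
      have "repulsion_kernel z \<le> ennreal (b powr (1 / \<alpha>2)) * (V + ennreal b / ennreal b)"
        using young[of "b powr (1 / \<alpha>2)"] b real \<alpha> by (simp add: powr_powr)
      also have "ennreal b / ennreal b = 1"
        using b by (simp add: divide_ennreal)
      finally show ?thesis using real by (simp add: epowr_def mult.commute)
    qed
  qed
qed

lemma repulsion_kernel_integrable:
  assumes \<alpha>: "\<alpha>1 > 1" "\<alpha>2 > 1" "1 / \<alpha>1 + 1 / \<alpha>2 = 1"
    and A1: "moment (2 * \<alpha>1) < \<infinity>"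
    and A2: "(\<integral>\<^sup>+z\<in>- ball 0 \<delta>. epowr (deviation_moment \<alpha>2 z) (1 / \<alpha>2) \<partial>lborel) < \<infinity>"
  shows "(\<integral>\<^sup>+z. repulsion_kernel z \<partial>lborel) < \<infinity>"
proof -
  define V where "V = 2 * (emeasure \<mu> UNIV * moment (2 * \<alpha>1))"
  define W where "W = 2 * (emeasure \<mu> UNIV * emeasure \<mu> UNIV) + V"
  have fin: "V < \<infinity>" "W < \<infinity>"
    using A1 finite_mark_mass unfolding V_def W_def
    by (auto simp: ennreal_mult_less_top)
  have [measurable]: "ball (0 :: 'a) \<delta> \<in> sets borel" by simp
  have [measurable]: "deviation_moment \<alpha>2 \<in> borel_measurable borel"
    unfolding deviation_moment_def[abs_def] by measurable
  have "(\<integral>\<^sup>+z. repulsion_kernel z \<partial>lborel)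
    \<le> (\<integral>\<^sup>+z. W * indicator (ball 0 \<delta>) z
        + (V + 1) * (epowr (deviation_moment \<alpha>2 z) (1 / \<alpha>2) * indicator (- ball 0 \<delta>) z) \<partial>lborel)"
    using repulsion_kernel_near[OF \<alpha>(1)] repulsion_kernel_Hoelder[OF \<alpha> A1]
    by (intro nn_integral_mono) (auto simp: indicator_def V_def W_def)
  also have "\<dots> = (\<integral>\<^sup>+z. W * indicator (ball (0 :: 'a) \<delta>) z \<partial>lborel)
      + (\<integral>\<^sup>+z. (V + 1) * (epowr (deviation_moment \<alpha>2 z) (1 / \<alpha>2) * indicator (- ball 0 \<delta>) z) \<partial>lborel)"
    by (rule nn_integral_add) measurable
  also have "(\<integral>\<^sup>+z. W * indicator (ball (0 :: 'a) \<delta>) z \<partial>lborel) = W * emeasure lborel (ball (0 :: 'a) \<delta>)"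
    by (rule nn_integral_cmult_indicator) simp
  also have "(\<integral>\<^sup>+z. (V + 1) * (epowr (deviation_moment \<alpha>2 z) (1 / \<alpha>2) * indicator (- ball 0 \<delta>) z) \<partial>lborel)
      = (V + 1) * (\<integral>\<^sup>+z\<in>- ball 0 \<delta>. epowr (deviation_moment \<alpha>2 z) (1 / \<alpha>2) \<partial>lborel)"
    by (rule nn_integral_cmult) measurable
  also have "W * emeasure lborel (ball (0 :: 'a) \<delta>)
      + (V + 1) * (\<integral>\<^sup>+z\<in>- ball 0 \<delta>. epowr (deviation_moment \<alpha>2 z) (1 / \<alpha>2) \<partial>lborel) < \<infinity>"
    using fin A2 emeasure_bounded_finite[OF bounded_ball, of "0 :: 'a" \<delta>]
    by (auto simp: ennreal_mult_less_top)
  finally show ?thesis .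
qed

end

section \<open>The lower bound on the variance\<close>

text \<open>The hypotheses say that \<open>N\<close> and \<open>L\<close> have the same mean \<open>c\<close>, that \<open>Cov(N, N - L) = c\<close>, and that
\<open>Var(N - L) \<le> c + v\<close>. The conclusion is the Cauchy-Schwarz inequality for \<open>N - c\<close> and \<open>N - L\<close> in its linear
form: integrate \<open>0 \<le> ((N - c) - t (N - L))\<^sup>2\<close>. The covariances are expressed by second moments in
\<open>[0, \<infinity>]\<close>, where they make sense for every \<open>N\<close>; if \<open>N\<close> is not square integrable, its variance is
infinite.\<close>

lemma (in prob_space) second_moment_lower_bound:
  fixes N :: "'a \<Rightarrow> real" and L :: "'a \<Rightarrow> ennreal" and c v t :: real
  assumes [measurable]: "N \<in> borel_measurable M" "L \<in> borel_measurable M"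
    and N: "\<And>x. 0 \<le> N x" and c: "0 \<le> c" and v: "0 \<le> v" and t: "0 \<le> t"
    and EN: "(\<integral>\<^sup>+x. ennreal (N x) \<partial>M) = ennreal c"
    and EL: "(\<integral>\<^sup>+x. L x \<partial>M) = ennreal c"
    and ENN: "(\<integral>\<^sup>+x. ennreal (N x) * ennreal (N x) \<partial>M) = (\<integral>\<^sup>+x. ennreal (N x) * L x \<partial>M) + ennreal c"
    and ELL: "(\<integral>\<^sup>+x. L x * L x \<partial>M) \<le> (\<integral>\<^sup>+x. ennreal (N x) * L x \<partial>M) + ennreal v"
  shows "ennreal (2 * t * c - t\<^sup>2 * (c + v)) \<le> (\<integral>\<^sup>+x. ennreal ((N x - (\<integral>x. N x \<partial>M))\<^sup>2) \<partial>M)"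
proof -
  have intN: "integrable M N"
    using EN N by (intro integrableI_bounded) auto
  have meanN: "(\<integral>x. N x \<partial>M) = c"
    using EN N c by (simp add: integral_eq_nn_integral)
  show ?thesis
    unfolding meanN
  proof (cases "(\<integral>\<^sup>+x. ennreal ((N x)\<^sup>2) \<partial>M) < \<infinity>")
    case False
    have "(\<integral>\<^sup>+x. ennreal ((N x - c)\<^sup>2) \<partial>M) = \<infinity>"
    proof (rule ccontr)
      assume "(\<integral>\<^sup>+x. ennreal ((N x - c)\<^sup>2) \<partial>M) \<noteq> \<infinity>"
      then have "integrable M (\<lambda>x. (N x - c)\<^sup>2)"
        by (intro integrableI_bounded) (auto simp: top.not_eq_extremum)
      then have "integrable M (\<lambda>x. (N x - c)\<^sup>2 + (2 * c * N x - c\<^sup>2))"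
        using intN by auto
      then have "integrable M (\<lambda>x. (N x)\<^sup>2)"
        by (simp add: power2_diff algebra_simps)
      with False show False by (simp add: integrable_iff_bounded)
    qed
    then show "ennreal (2 * t * c - t\<^sup>2 * (c + v)) \<le> (\<integral>\<^sup>+x. ennreal ((N x - c)\<^sup>2) \<partial>M)" by simp
  next
    case True
    \<comment> \<open>from here on all moments are finite, and \<open>L\<close> is replaced by a real version of itself\<close>
    define R where "R x = enn2real (L x)" for x
    have [measurable]: "R \<in> borel_measurable M" unfolding R_def by measurable
    have Rpos: "0 \<le> R x" for x by (simp add: R_def)
    have "AE x in M. L x \<noteq> \<infinity>"
      using EL by (intro nn_integral_PInf_AE) auto
    then have LR: "AE x in M. L x = ennreal (R x)"
      by eventually_elim (simp add: R_def top.not_eq_extremum)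
    have ER: "(\<integral>\<^sup>+x. ennreal (R x) \<partial>M) = ennreal c"
      using EL nn_integral_cong_AE[OF LR] by simp
    have NL: "(\<integral>\<^sup>+x. ennreal (N x) * L x \<partial>M) = (\<integral>\<^sup>+x. ennreal (N x * R x) \<partial>M)"
      by (rule nn_integral_cong_AE) (use LR in eventually_elim, simp add: N ennreal_mult')
    have LL: "(\<integral>\<^sup>+x. L x * L x \<partial>M) = (\<integral>\<^sup>+x. ennreal ((R x)\<^sup>2) \<partial>M)"
      by (rule nn_integral_cong_AE) (use LR in eventually_elim, simp add: Rpos ennreal_mult' power2_eq_square)
    have NN: "(\<integral>\<^sup>+x. ennreal (N x) * ennreal (N x) \<partial>M) = (\<integral>\<^sup>+x. ennreal ((N x)\<^sup>2) \<partial>M)"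
      by (simp add: N ennreal_mult' power2_eq_square)
    have finNR: "(\<integral>\<^sup>+x. ennreal (N x * R x) \<partial>M) < \<infinity>"
      using True unfolding NN[symmetric] ENN NL by simp
    have finRR: "(\<integral>\<^sup>+x. ennreal ((R x)\<^sup>2) \<partial>M) < \<infinity>"
      using ELL finNR unfolding NL LL by (auto intro: le_less_trans)
    have int: "integrable M R" "integrable M (\<lambda>x. N x * R x)" "integrable M (\<lambda>x. (N x)\<^sup>2)"
        "integrable M (\<lambda>x. (R x)\<^sup>2)"
      using ER finNR True finRR N Rpos by (auto intro!: integrableI_bounded simp: abs_mult)
    have eR: "(\<integral>x. R x \<partial>M) = c"
      using ER Rpos c by (simp add: integral_eq_nn_integral)
    have "ennreal (\<integral>x. (N x)\<^sup>2 \<partial>M) = ennreal ((\<integral>x. N x * R x \<partial>M) + c)"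
      using ENN c int N Rpos unfolding NN NL by (simp add: nn_integral_eq_integral ennreal_plus)
    then have eNN: "(\<integral>x. (N x)\<^sup>2 \<partial>M) = (\<integral>x. N x * R x \<partial>M) + c"
      using c N Rpos by (subst (asm) ennreal_inj) (auto intro!: add_nonneg_nonneg integral_nonneg)
    have "ennreal (\<integral>x. (R x)\<^sup>2 \<partial>M) \<le> ennreal ((\<integral>x. N x * R x \<partial>M) + v)"
      using ELL v int N Rpos unfolding LL NL by (simp add: nn_integral_eq_integral ennreal_plus)
    then have eRR: "(\<integral>x. (R x)\<^sup>2 \<partial>M) \<le> (\<integral>x. N x * R x \<partial>M) + v"
      using v N Rpos by (subst (asm) ennreal_le_iff) (auto intro!: add_nonneg_nonneg integral_nonneg)
    let ?g = "\<lambda>x. 2 * t * ((N x)\<^sup>2 - N x * R x - c * N x + c * R x)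
      - t\<^sup>2 * ((N x)\<^sup>2 - 2 * (N x * R x) + (R x)\<^sup>2)"
    have intg: "integrable M ?g" using int intN by auto
    have "2 * t * c - t\<^sup>2 * (c + v) \<le> 2 * t * c - t\<^sup>2 * (c - (\<integral>x. N x * R x \<partial>M) + (\<integral>x. (R x)\<^sup>2 \<partial>M))"
      using eRR t by (intro diff_mono mult_left_mono) auto
    also have "\<dots> = 2 * t * ((\<integral>x. (N x)\<^sup>2 \<partial>M) - (\<integral>x. N x * R x \<partial>M) - c * c + c * c)
        - t\<^sup>2 * ((\<integral>x. (N x)\<^sup>2 \<partial>M) - 2 * (\<integral>x. N x * R x \<partial>M) + (\<integral>x. (R x)\<^sup>2 \<partial>M))"
      by (simp add: eNN algebra_simps)
    also have "\<dots> = (\<integral>x. ?g x \<partial>M)"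
      using int intN by (simp add: meanN eR)
    also have "\<dots> \<le> (\<integral>x. (N x - c)\<^sup>2 \<partial>M)"
    proof (rule integral_mono[OF intg])
      show "integrable M (\<lambda>x. (N x - c)\<^sup>2)"
        using int intN by (simp add: power2_diff)
      fix x
      have "0 \<le> ((N x - c) - t * (N x - R x))\<^sup>2" by simp
      then show "?g x \<le> (N x - c)\<^sup>2" by (simp add: power2_eq_square algebra_simps)
    qed
    finally have "ennreal (2 * t * c - t\<^sup>2 * (c + v)) \<le> ennreal (\<integral>x. (N x - c)\<^sup>2 \<partial>M)"
      by (rule ennreal_leI)
    also have "\<dots> = (\<integral>\<^sup>+x. ennreal ((N x - c)\<^sup>2) \<partial>M)"
      by (rule nn_integral_eq_integral[symmetric]) (use int intN in \<open>simp add: power2_diff\<close>, simp)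
    finally show "ennreal (2 * t * c - t\<^sup>2 * (c + v)) \<le> (\<integral>\<^sup>+x. ennreal ((N x - c)\<^sup>2) \<partial>M)" .
  qed
qed

context stationary_gibbs
begin

lemma intensity_finite:
  assumes p: "p \<ge> 1" and fin: "moment p < \<infinity>"
  shows "intensity < \<infinity>"
proof -
  have bd: "lam x \<gamma> \<le> 1 + ennreal (\<bar>l x \<gamma>\<bar> powr p)" for x \<gamma>
  proof -
    have "l x \<gamma> \<le> 1 + \<bar>l x \<gamma>\<bar> powr p"
    proof (cases "l x \<gamma> \<le> 1")
      case False
      then have "l x \<gamma> powr 1 \<le> l x \<gamma> powr p" using p by (intro powr_mono) auto
      with False show ?thesis by simp
    qed (simp add: add_increasing2)
    then have "lam x \<gamma> \<le> ennreal (1 + \<bar>l x \<gamma>\<bar> powr p)" by (rule ennreal_leI)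
    then show ?thesis by (simp add: ennreal_plus)
  qed
  have "intensity \<le> (\<integral>\<^sup>+m. \<integral>\<^sup>+\<gamma>. 1 + ennreal (\<bar>l (0, m) \<gamma>\<bar> powr p) \<partial>\<Gamma> \<partial>\<mu>)"
    unfolding intensity_def by (intro nn_integral_mono bd)
  also have "\<dots> = (\<integral>\<^sup>+m. 1 + (\<integral>\<^sup>+\<gamma>. ennreal (\<bar>l (0, m) \<gamma>\<bar> powr p) \<partial>\<Gamma>) \<partial>\<mu>)"
    using \<Gamma>.emeasure_space_1 by (subst nn_integral_add) auto
  also have "\<dots> = emeasure \<mu> UNIV + moment p"
    unfolding moment_def by (subst nn_integral_add) auto
  also have "\<dots> < \<infinity>" using fin finite_mark_mass by simp
  finally show ?thesis .
qed

text \<open>With zero intensity, each of the countably many windows \<open>ball 0 n\<close> is almost surely empty.\<close>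

lemma intensity_pos:
  assumes "\<not> (AE \<gamma> in \<Gamma>. \<gamma> = {})"
  shows "intensity > 0"
proof (rule ccontr)
  assume "\<not> intensity > 0"
  then have zero: "intensity = 0" by simp
  have "AE \<gamma> in \<Gamma>. num_points (ball 0 (real n)) \<gamma> = 0" for n
  proof -
    note [measurable] = measurable_num_points[OF bounded_ball borel_open[OF open_ball], where 'm = 'm]
    have "(\<integral>\<^sup>+\<gamma>. ennreal (num_points (ball 0 (real n)) \<gamma>) \<partial>\<Gamma>) = 0"
      by (simp add: gnz_count nn_integral_compensator zero)
    then have "AE \<gamma> in \<Gamma>. ennreal (num_points (ball 0 (real n)) \<gamma>) = 0"
      by (subst (asm) nn_integral_0_iff_AE) auto
    then show ?thesis by eventually_elim (simp add: num_points_def)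
  qed
  then have "AE \<gamma> in \<Gamma>. \<forall>n. num_points (ball 0 (real n)) \<gamma> = 0"
    by (subst AE_all_countable) auto
  then have "AE \<gamma> in \<Gamma>. \<gamma> = {}"
    using AE_space
  proof eventually_elim
    case (elim \<gamma>)
    show ?case
    proof (rule ccontr)
      assume "\<gamma> \<noteq> {}"
      then obtain x m where x: "(x, m) \<in> \<gamma>" by auto
      obtain n where n: "norm x < real n" using reals_Archimedean2 by blast
      have "finite (\<gamma> \<inter> ball 0 (real n) \<times> UNIV)"
        using elim(2) by (intro finite_in_bounded_window) auto
      moreover have "card (\<gamma> \<inter> ball 0 (real n) \<times> UNIV) = 0"
        using elim(1) by (simp add: num_points_def)
      ultimately show False using x n by auto
    qed
  qed
  with assms show False by contradiction
qed

lemma num_variance_lower_bound: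
  assumes \<Lambda>: "bounded \<Lambda>" "\<Lambda> \<in> sets borel"
    and \<rho>: "intensity = ennreal \<rho>" "\<rho> > 0"
    and \<kappa>: "(\<integral>\<^sup>+z. repulsion_kernel z \<partial>lborel) = ennreal \<kappa>" "\<kappa> \<ge> 0"
  shows "ennreal (\<rho>\<^sup>2 / (\<rho> + \<kappa>)) * emeasure lborel \<Lambda> \<le> num_variance \<Gamma> \<Lambda>"
proof -
  note [measurable] = \<Lambda>(2)
  note num_meas [measurable] = measurable_num_points[OF \<Lambda>, where 'm = 'm]
  obtain a where a: "emeasure lborel \<Lambda> = ennreal a" "a \<ge> 0"
    using emeasure_bounded_finite[OF \<Lambda>(1)] by (cases "emeasure lborel \<Lambda>") auto
  have L: "(\<integral>\<^sup>+\<gamma>. compensator \<Lambda> \<gamma> \<partial>\<Gamma>) = ennreal (\<rho> * a)"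
    using \<rho> a by (simp add: nn_integral_compensator ennreal_mult')
  \<comment> \<open>the maximiser of \<open>2 t \<rho> - t\<^sup>2 (\<rho> + \<kappa>)\<close>, the lower bound per unit volume\<close>
  define t where "t = \<rho> / (\<rho> + \<kappa>)"
  have "ennreal (2 * t * (\<rho> * a) - t\<^sup>2 * (\<rho> * a + \<kappa> * a)) \<le> num_variance \<Gamma> \<Lambda>"
    unfolding num_variance_def
  proof (rule \<Gamma>.second_moment_lower_bound)
    show "num_points \<Lambda> \<in> borel_measurable \<Gamma>" by measurable
    show "compensator \<Lambda> \<in> borel_measurable \<Gamma>"
      using measurable_compensator[of "\<lambda>\<gamma>. \<gamma>" \<Gamma> \<Lambda>] by simp
    show "(\<integral>\<^sup>+\<gamma>. ennreal (num_points \<Lambda> \<gamma>) \<partial>\<Gamma>) = ennreal (\<rho> * a)"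
      using L by (simp add: gnz_count \<Lambda>)
    show "(\<integral>\<^sup>+\<gamma>. ennreal (num_points \<Lambda> \<gamma>) * ennreal (num_points \<Lambda> \<gamma>) \<partial>\<Gamma>)
      = (\<integral>\<^sup>+\<gamma>. ennreal (num_points \<Lambda> \<gamma>) * compensator \<Lambda> \<gamma> \<partial>\<Gamma>) + ennreal (\<rho> * a)"
      using gnz_count_squared[OF \<Lambda>] L by simp
    show "(\<integral>\<^sup>+\<gamma>. compensator \<Lambda> \<gamma> * compensator \<Lambda> \<gamma> \<partial>\<Gamma>)
      \<le> (\<integral>\<^sup>+\<gamma>. ennreal (num_points \<Lambda> \<gamma>) * compensator \<Lambda> \<gamma> \<partial>\<Gamma>) + ennreal (\<kappa> * a)"
      using compensator_squared_le[OF \<Lambda>] \<kappa> a by (simp add: ennreal_mult')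
  qed (use \<rho> \<kappa> a L in \<open>auto simp: t_def num_points_def\<close>)
  also have "2 * t * (\<rho> * a) - t\<^sup>2 * (\<rho> * a + \<kappa> * a) = \<rho>\<^sup>2 / (\<rho> + \<kappa>) * a"
  proof -
    have "t * (\<rho> + \<kappa>) = \<rho>" using \<rho> \<kappa> by (simp add: t_def)
    then have "t\<^sup>2 * (\<rho> * a + \<kappa> * a) = t * \<rho> * a"
      by (metis (no_types, lifting) distrib_right mult.assoc power2_eq_square)
    then have "2 * t * (\<rho> * a) - t\<^sup>2 * (\<rho> * a + \<kappa> * a) = t * \<rho> * a" by simp
    then show ?thesis by (simp add: t_def power2_eq_square)
  qed
  also have "ennreal (\<rho>\<^sup>2 / (\<rho> + \<kappa>) * a) = ennreal (\<rho>\<^sup>2 / (\<rho> + \<kappa>)) * emeasure lborel \<Lambda>"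
    unfolding a(1) by (rule ennreal_mult') (use \<rho> \<kappa> in simp)
  finally show ?thesis .
qed

end

lemma not_hyperuniform_if_variance_bounded_below:
  fixes \<Gamma> :: "('a::euclidean_space, 'm::polish_space) config measure"
  assumes "C > 0"
    and bound: "\<And>\<Lambda> :: 'a set. bounded \<Lambda> \<Longrightarrow> \<Lambda> \<in> sets borel \<Longrightarrow> emeasure lborel \<Lambda> > 0 \<Longrightarrow>
      ennreal C \<le> num_variance \<Gamma> \<Lambda> / emeasure lborel \<Lambda>"
  shows "\<not> hyperuniform \<Gamma>"
proof
  assume hyp: "hyperuniform \<Gamma>"
  let ?B = "\<lambda>n :: nat. ball (0 :: 'a) (real (Suc n))"
  have "incseq ?B" by (auto simp: incseq_def)
  moreover have "(\<Union>n. ?B n) = UNIV"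
  proof (intro equalityI subsetI UN_iff[THEN iffD2])
    fix x :: 'a
    obtain n where "norm x < real n" using reals_Archimedean2 by blast
    then show "\<exists>n\<in>UNIV. x \<in> ?B n" by (intro bexI[of _ n]) auto
  qed simp
  ultimately have "(\<lambda>n. num_variance \<Gamma> (?B n) / emeasure lborel (?B n)) \<longlonglongrightarrow> 0"
    using hyp unfolding hyperuniform_def by simp
  moreover have "ennreal C \<le> num_variance \<Gamma> (?B n) / emeasure lborel (?B n)" for n
  proof (rule bound)
    have "measure lborel (?B n) > 0" by (rule content_ball_pos) simp
    then show "emeasure lborel (?B n) > 0" by (simp add: measure_def enn2real_positive_iff)
  qed auto
  ultimately have "ennreal C \<le> 0" by (intro LIMSEQ_le_const) auto
  with \<open>C > 0\<close> show False by simp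
qed

theorem theorem2:
  fixes \<mu> :: "'m::polish_space measure"
    and \<Gamma> :: "('a::euclidean_space, 'm) config measure"
    and l :: "'a \<times> 'm \<Rightarrow> ('a, 'm) config \<Rightarrow> real"
    and \<alpha>1 \<alpha>2 \<delta> :: real
  assumes mark_sets: "sets \<mu> = sets borel"
    and mark_finite: "finite_measure \<mu>"
    and stat: "stationary \<Gamma>"
    and gibbs: "gibbs_papangelou \<mu> \<Gamma> l"
    and inv: "translation_invariant l"
    and nonempty: "\<not> (AE \<gamma> in \<Gamma>. \<gamma> = {})"
    and exponents: "\<alpha>1 > 1" "\<alpha>2 > 1" "1 / \<alpha>1 + 1 / \<alpha>2 = 1"
    and delta: "\<delta> \<ge> 0"
    and A1: "(\<integral>\<^sup>+m. (\<integral>\<^sup>+\<gamma>. ennreal (\<bar>l (0, m) \<gamma>\<bar> powr (2 * \<alpha>1)) \<partial>\<Gamma>) \<partial>\<mu>) < \<infinity>"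
    and A2: "(\<integral>\<^sup>+y\<in>- ball 0 \<delta>.
                epowr (\<integral>\<^sup>+(m1, m2).
                         (\<integral>\<^sup>+\<gamma>. epowr (ratio_dev (l (0, m1) (\<gamma> \<union> {(y, m2)})) (l (0, m1) \<gamma>)) \<alpha>2 \<partial>\<Gamma>)
                       \<partial>(\<mu> \<Otimes>\<^sub>M \<mu>)) (1 / \<alpha>2)
              \<partial>lborel) < \<infinity>"
  shows "(\<exists>C::real. C > 0 \<and>
            (\<forall>\<Lambda>::'a set. bounded \<Lambda> \<longrightarrow> \<Lambda> \<in> sets borel \<longrightarrow> emeasure lborel \<Lambda> > 0 \<longrightarrow>
               num_variance \<Gamma> \<Lambda> / emeasure lborel \<Lambda> \<ge> ennreal C))
         \<and> \<not> hyperuniform \<Gamma>"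
proof -
  interpret stationary_gibbs \<mu> \<Gamma> l
    by (rule stationary_gibbs.intro) fact+
  have moment: "moment (2 * \<alpha>1) < \<infinity>" using A1 by (simp only: moment_def)
  have "(\<integral>\<^sup>+z. repulsion_kernel z \<partial>lborel) < \<infinity>"
    using repulsion_kernel_integrable[OF exponents moment] A2 by (simp only: deviation_moment_def)
  then obtain \<kappa> where \<kappa>: "(\<integral>\<^sup>+z. repulsion_kernel z \<partial>lborel) = ennreal \<kappa>" "\<kappa> \<ge> 0"
    by (cases "\<integral>\<^sup>+z. repulsion_kernel z \<partial>lborel") auto
  have "intensity < \<infinity>" using exponents(1) by (intro intensity_finite[OF _ moment]) simp
  then obtain \<rho> where \<rho>: "intensity = ennreal \<rho>" "\<rho> > 0"
    using intensity_pos[OF nonempty] by (cases intensity) auto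
  define C where "C = \<rho>\<^sup>2 / (\<rho> + \<kappa>)"
  have C: "C > 0" using \<rho>(2) \<kappa>(2) by (simp add: C_def)
  have bound: "ennreal C \<le> num_variance \<Gamma> \<Lambda> / emeasure lborel \<Lambda>"
    if "bounded \<Lambda>" "\<Lambda> \<in> sets borel" "emeasure lborel \<Lambda> > 0" for \<Lambda> :: "'a set"
  proof -
    have fin: "emeasure lborel \<Lambda> < \<infinity>" by (rule emeasure_bounded_finite[OF that(1)])
    have "ennreal C = ennreal C * emeasure lborel \<Lambda> / emeasure lborel \<Lambda>"
      using that(3) fin by (simp add: ennreal_mult_divide_eq)
    also have "\<dots> \<le> num_variance \<Gamma> \<Lambda> / emeasure lborel \<Lambda>"
      unfolding C_def by (intro divide_right_mono_ennreal num_variance_lower_bound that \<rho> \<kappa>)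
    finally show ?thesis .
  qed
  show ?thesis
    using C bound not_hyperuniform_if_variance_bounded_below[OF C bound] by blast
qed

end
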